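(* Let $\mathbb{K}$ be a field, $S=\mathbb{K}[x_1,\dots,x_n]$, $1\le r\le n$, $S'=\mathbb{K}[x_1,\dots,x_r]$ and $S''=\mathbb{K}[x_{r+1},\dots,x_n]$. Let $I$ be a monomial ideal of $S$ and let $I=Q_1\cap\cdots\cap Q_s$, $s\ge 2$, be the unique irredundant presentation of $I$ as an intersection of irreducible monomial ideals. Suppose that one of the ideals $Q_1,\dots,Q_s$ is $(x_1^{a_1},\dots,x_r^{a_r})$, where $a_1,\dots,a_r$ are positive integers. Then $$\mathrm{sdepth}_S(S/I)\ \ge\ \min\Big\{\,n-r,\ \ \mathrm{sdepth}_{S_\tau}\Big(\bigcap_{j\in[s]\setminus\tau}(Q_j:w)\cap S_\tau\Big)+\mathrm{sdepth}_{S''}\Big(S''\Big/\Big(\bigcap_{j\in\tau}Q_j\cap S''\Big)\Big)\Big\},$$ where the minimum is taken over $n-r$ and over all values of the second expression as $\tau$ ranges over the nonempty proper subsets of $[s]$ and $w$ ranges over the elements of $\mathcal{M}_\tau$ such that $\bigcap_{j\in[s]\setminus\tau}Q_j\cap wS_\tau\neq 0$.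
   Context: Notation: $[s]=\{1,\dots,s\}$. A monomial ideal is irreducible iff it is generated by pure powers of variables; every monomial ideal has a unique irredundant presentation as an intersection of irreducible monomial ideals. For a proper subset $\tau\subset[s]$, $S_\tau=\mathbb{K}\big[x_i \mid 1\le i\le r,\ x_i\notin\sum_{j\in\tau}\sqrt{Q_j}\big]$ (equal to $\mathbb{K}$ if there is no such variable), and $\mathcal{M}_\tau$ is the set of all monomials $u\in S'$ with $u\notin\sum_{j\in\tau}Q_j$ and $u\in\mathbb{K}\big[x_i\mid x_i\in\sum_{j\in\tau}\sqrt{Q_j}\big]$. Here $(Q_j:w)=\{f\in S\mid fw\in Q_j\}$ and $wS_\tau=\{wf\mid f\in S_\tau\}$. An expression such as $\bigcap_{j}Q_j\cap A$ means $\big(\bigcap_j Q_j\big)\cap A$. Stanley depth: let $R$ be a polynomial ring over $\mathbb{K}$ in a finite set $X$ of variables, and let $M$ be a nonzero finitely generated $\mathbb{Z}^{X}$-graded $R$-module. For a homogeneous $u\in M$ and $Z\subseteq X$, the $\mathbb{K}$-subspace $u\mathbb{K}[Z]$ generated by all $uv$ with $v\in\mathbb{K}[Z]$ is called a Stanley space of dimension $|Z|$ if it is a free $\mathbb{K}[Z]$-module. A Stanley decomposition $\mathcal{D}$ of $M$ is a decomposition of $M$, as a $\mathbb{K}$-vector space, into a finite direct sum of Stanley spaces; $\mathrm{sdepth}(\mathcal{D})$ is the minimum dimension of a Stanley space in $\mathcal{D}$, and $\mathrm{sdepth}_R(M)$ is the maximum of $\mathrm{sdepth}(\mathcal{D})$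 over all Stanley decompositions $\mathcal{D}$ of $M$. *)

theory Defs
  imports "HOL-Algebra.QuotRing" "HOL-Algebra.Module" "HOL-Library.Poly_Mapping"
begin

section \<open>Polynomial rings and monomial ideals\<close>

text \<open>
  A power product is a finitely supported exponent vector \<^typ>\<open>'v \<Rightarrow>\<^sub>0 nat\<close>, and a polynomial is a
  finitely supported function from power products to coefficients; multiplication of
  \<^typ>\<open>('v \<Rightarrow>\<^sub>0 nat) \<Rightarrow>\<^sub>0 'k\<close> is convolution.
\<close>

type_synonym ('v, 'k) mpol = "('v \<Rightarrow>\<^sub>0 nat) \<Rightarrow>\<^sub>0 'k"

definition mono :: "('v \<Rightarrow>\<^sub>0 nat) \<Rightarrow> ('v, 'k::field) mpol" where
  "mono e = Poly_Mapping.single e 1"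

definition var :: "'v \<Rightarrow> ('v, 'k::field) mpol" where
  "var i = mono (Poly_Mapping.single i 1)"

text \<open>The polynomial ring $K[x_i \mid i \in X]$, for a set \<open>X\<close> of (indices of) variables.\<close>

definition poly_ring :: "'v set \<Rightarrow> ('v, 'k::field) mpol ring" where
  "poly_ring X =
    \<lparr>carrier = {p. \<forall>e\<in>Poly_Mapping.keys p. Poly_Mapping.keys e \<subseteq> X},
     mult = (*), one = 1, zero = 0, add = (+)\<rparr>"

definition monomials :: "'v set \<Rightarrow> ('v, 'k::field) mpol set" where
  "monomials X = {mono e |e. Poly_Mapping.keys e \<subseteq> X}"

definition monomial_ideal :: "'v set \<Rightarrow> ('v, 'k::field) mpol set \<Rightarrow> bool" where
  "monomial_ideal X I \<longleftrightarrow> (\<exists>A\<subseteq>monomials X. I = Idl\<^bsub>poly_ring X\<^esub> A)"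

definition irreducible_monomial_ideal :: "'v set \<Rightarrow> ('v, 'k::field) mpol set \<Rightarrow> bool" where
  "irreducible_monomial_ideal X I \<longleftrightarrow>
    (\<exists>A \<subseteq> {var i ^ m |i m. i \<in> X \<and> 0 < m}. I = Idl\<^bsub>poly_ring X\<^esub> A)"

definition irredundant_irreducible_presentation ::
    "'v set \<Rightarrow> nat \<Rightarrow> (nat \<Rightarrow> ('v, 'k::field) mpol set) \<Rightarrow> ('v, 'k) mpol set \<Rightarrow> bool" where
  "irredundant_irreducible_presentation X s Q I \<longleftrightarrow>
    (\<forall>j\<in>{1..s}. irreducible_monomial_ideal X (Q j)) \<and>
    I = (\<Inter>j\<in>{1..s}. Q j) \<and>
    (\<forall>k\<in>{1..s}. (\<Inter>j\<in>{1..s} - {k}. Q j) \<noteq> I)"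

definition radical :: "'v set \<Rightarrow> ('v, 'k::field) mpol set \<Rightarrow> ('v, 'k) mpol set" where
  "radical X I = {f \<in> carrier (poly_ring X). \<exists>m. f ^ m \<in> I}"

definition ideal_sum :: "'i set \<Rightarrow> ('i \<Rightarrow> ('v, 'k::field) mpol set) \<Rightarrow> ('v, 'k) mpol set" where
  "ideal_sum T A = {\<Sum>j\<in>T. f j |f. \<forall>j\<in>T. f j \<in> A j}"

definition colon ::
    "'v set \<Rightarrow> ('v, 'k::field) mpol set \<Rightarrow> ('v, 'k) mpol \<Rightarrow> ('v, 'k) mpol set" where
  "colon X J w = {f \<in> carrier (poly_ring X). f * w \<in> J}"

section \<open>Multigraded modules and Stanley depth\<close>

text \<open>
  A module over $K[x_i \mid i \in X]$ together with its homogeneous components, which are indexed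
  by \<open>\<int>\<^sup>X\<close>: a degree is a finitely supported integer vector whose keys lie in \<open>X\<close>.
\<close>

record ('a, 'b, 'v) graded_module = "('a, 'b) module" +
  component :: "('v \<Rightarrow>\<^sub>0 int) \<Rightarrow> 'b set"

definition homogeneous :: "'v set \<Rightarrow> ('a, 'b, 'v) graded_module \<Rightarrow> 'b \<Rightarrow> bool" where
  "homogeneous X M u \<longleftrightarrow> (\<exists>g. Poly_Mapping.keys g \<subseteq> X \<and> u \<in> component M g)"

text \<open>
  An \<open>R\<close>-module is free if it has a basis, i.e. a subset \<open>B\<close> such that every element is a finite
  linear combination of \<open>B\<close> with uniquely determined coefficients.
\<close>

definition free_module :: "('a, 'r) ring_scheme \<Rightarrow> ('a, 'b, 'm) module_scheme \<Rightarrow> bool" where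
  "free_module R N \<longleftrightarrow>
    (\<exists>B\<subseteq>carrier N. \<forall>y\<in>carrier N.
      \<exists>!c. c \<in> B \<rightarrow>\<^sub>E carrier R \<and> finite {b\<in>B. c b \<noteq> \<zero>\<^bsub>R\<^esub>} \<and>
           y = (\<Oplus>\<^bsub>N\<^esub>b\<in>{b\<in>B. c b \<noteq> \<zero>\<^bsub>R\<^esub>}. c b \<odot>\<^bsub>N\<^esub> b))"

definition span_space ::
    "(('v, 'k::field) mpol, 'b, 'v) graded_module \<Rightarrow> 'b \<Rightarrow> 'v set \<Rightarrow> 'b set" where
  "span_space M u Z = {v \<odot>\<^bsub>M\<^esub> u |v. v \<in> carrier (poly_ring Z)}"

definition stanley_space ::
    "'v set \<Rightarrow> (('v, 'k::field) mpol, 'b, 'v) graded_module \<Rightarrow> 'b \<Rightarrow> 'v set \<Rightarrow> bool" where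
  "stanley_space X M u Z \<longleftrightarrow>
    u \<in> carrier M \<and> homogeneous X M u \<and> Z \<subseteq> X \<and>
    free_module (poly_ring Z :: ('v, 'k) mpol ring) (M\<lparr>carrier := span_space M u Z\<rparr>)"

text \<open>
  A Stanley decomposition is given by the finite set of the pairs \<open>(u, Z)\<close> that describe its
  summands.
\<close>

definition stanley_decomposition ::
    "'v set \<Rightarrow> (('v, 'k::field) mpol, 'b, 'v) graded_module \<Rightarrow> ('b \<times> 'v set) set \<Rightarrow> bool" where
  "stanley_decomposition X M D \<longleftrightarrow>
    finite D \<and> (\<forall>(u, Z)\<in>D. stanley_space X M u Z) \<and>
    (\<forall>y\<in>carrier M. \<exists>!f. f \<in> (\<Pi>\<^sub>E (u, Z)\<in>D. span_space M u Z) \<and> y = (\<Oplus>\<^bsub>M\<^esub>d\<in>D. f d))"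

definition sdepth_decomposition :: "('b \<times> 'v set) set \<Rightarrow> nat" where
  "sdepth_decomposition D = Min ((\<lambda>(u, Z). card Z) ` D)"

text \<open>
  For a finite set \<open>X\<close> of variables and a nonzero finitely generated module \<open>M\<close>, the set below is
  nonempty and bounded by \<open>card X\<close>.
\<close>

definition sdepth :: "'v set \<Rightarrow> (('v, 'k::field) mpol, 'b, 'v) graded_module \<Rightarrow> nat" where
  "sdepth X M = Max {sdepth_decomposition D |D. stanley_decomposition X M D}"

subsection \<open>Monomial ideals and their quotients as multigraded modules\<close>

text \<open>
  The standard grading: the exponent vectors of \<open>f\<close> all equal \<open>g\<close>, hence \<open>f\<close> is \<open>0\<close> if \<open>g\<close> has a
  negative entry.
\<close>

definition has_degree :: "('v, 'k::field) mpol \<Rightarrow> ('v \<Rightarrow>\<^sub>0 int) \<Rightarrow> bool" where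
  "has_degree f g \<longleftrightarrow> (\<forall>e\<in>Poly_Mapping.keys f. Poly_Mapping.map int e = g)"

text \<open>
  The fields \<open>mult\<close> and \<open>one\<close> below are inherited from the library's record of modules and play no
  role for modules.
\<close>

definition ideal_module ::
    "('v, 'k::field) mpol set \<Rightarrow> (('v, 'k) mpol, ('v, 'k) mpol, 'v) graded_module" where
  "ideal_module J =
    \<lparr>carrier = J, mult = (*), one = 1, zero = 0, add = (+), smult = (*),
     component = (\<lambda>g. {f \<in> J. has_degree f g})\<rparr>"

definition quotient_module ::
    "'v set \<Rightarrow> ('v, 'k::field) mpol set \<Rightarrow> (('v, 'k) mpol, ('v, 'k) mpol set, 'v) graded_module"
  where
  "quotient_module X J =
    (let R = poly_ring X; F = R Quot J in
     \<lparr>carrier = carrier F, mult = mult F, one = one F, zero = zero F, add = add F,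
      smult = (\<lambda>p C. [mod J:] (J +>\<^bsub>R\<^esub> p) \<Otimes>\<^bsub>R\<^esub> C),
      component = (\<lambda>g. {J +>\<^bsub>R\<^esub> f |f. f \<in> carrier R \<and> has_degree f g})\<rparr>)"

section \<open>The data attached to a set of indices\<close>

text \<open>
  Throughout, the ambient ring is $S = K[x_1, \dots, x_n]$ and the smaller ring is
  $S' = K[x_1, \dots, x_r]$.
\<close>

text \<open>The indices of the variables of $S_\tau$.\<close>

definition vars_S\<tau> ::
    "nat \<Rightarrow> nat \<Rightarrow> (nat \<Rightarrow> (nat, 'k::field) mpol set) \<Rightarrow> nat set \<Rightarrow> nat set" where
  "vars_S\<tau> n r Q \<tau> =
    {i\<in>{1..r}. (var i :: (nat, 'k) mpol) \<notin> ideal_sum \<tau> (\<lambda>j. radical {1..n} (Q j))}"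

definition S\<tau> ::
    "nat \<Rightarrow> nat \<Rightarrow> (nat \<Rightarrow> (nat, 'k::field) mpol set) \<Rightarrow> nat set \<Rightarrow> (nat, 'k) mpol ring" where
  "S\<tau> n r Q \<tau> = poly_ring (vars_S\<tau> n r Q \<tau>)"

definition M\<tau> ::
    "nat \<Rightarrow> nat \<Rightarrow> (nat \<Rightarrow> (nat, 'k::field) mpol set) \<Rightarrow> nat set \<Rightarrow> (nat, 'k) mpol set" where
  "M\<tau> n r Q \<tau> =
    {u \<in> monomials {1..r}. u \<notin> ideal_sum \<tau> Q \<and>
      u \<in> carrier (poly_ring
        {i\<in>{1..n}. (var i :: (nat, 'k) mpol) \<in> ideal_sum \<tau> (\<lambda>j. radical {1..n} (Q j))})}"

end

theory Submission
  imports Defs "HOL-Library.Disjoint_Sets"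
begin

text \<open>
  The monomials outside \<open>I\<close> are a basis of \<open>S/I\<close>, and Stanley decompositions of a quotient of monomial
  ideals amount to partitions of its monomial basis into cones. Write a monomial as \<open>u' u''\<close> with \<open>u'\<close> in
  the first \<open>r\<close> variables and \<open>u''\<close> in the others. An irreducible monomial ideal contains \<open>u' u''\<close> iff it
  contains \<open>u'\<close> or \<open>u''\<close>. The finitely many \<open>u'\<close> outside the distinguished component contribute copies of
  \<open>S''\<close>, of dimension \<open>n - r\<close>. For any other \<open>u'\<close> let \<open>\<tau>\<close> be the set of those \<open>j\<close> with \<open>u'\<close> not in \<open>Q\<^sub>j\<close>,
  and write \<open>u' = w v\<close> where \<open>w\<close> collects the variables in the radicals of the \<open>Q\<^sub>j\<close>, \<open>j\<close> in \<open>\<tau>\<close>. For fixed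
  \<open>\<tau>\<close> and \<open>w\<close>, the admissible \<open>v\<close> are the monomials of the intersected colon ideals in \<open>S\<^sub>\<tau>\<close>, and
  independently of \<open>v\<close> the admissible \<open>u''\<close> are those outside the intersection of the \<open>Q\<^sub>j\<close>, \<open>j\<close> in \<open>\<tau>\<close>.
  Optimal cone partitions of the two sets multiply.
\<close>

section \<open>Partitions of sets of exponent vectors into cones\<close>

text \<open>\<open>sdepth\<close> is a \<open>Max\<close>, so it carries information only for a
  finite nonempty set of values. All values are at most \<open>card X\<close>, which gives
  finiteness. Nonemptiness needs some cone partition, whatever its dimensions: it comes from
  truncating exponents at a common bound \<open>N\<close> of the exponents of all generators. The
  maximum is then attained, and optimal decompositions of the two factors can be turned back into
  cone partitions. This is the delicate direction, since freeness only provides some basis: if a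
  cone left the monomial basis of the module, a monomial would kill a basis element and zero would
  have two expansions. For S/I only the passage from a partition to a decomposition is needed. The
  set \<tau> is proper because u' lies in the distinguished component, whose index is therefore
  outside \<tau>; it is nonempty because the whole monomial is outside I. The factor v contains no
  variable that could affect membership in a Q_j with j in \<tau>, so \<tau> and w can be read off
  from u', which makes the blocks disjoint. The exponents of w stay below those of the generators,
  so only finitely many pairs (\<tau>, w) occur and the minimum in the statement is over a finite
  set.\<close>

definition exps :: "'v set \<Rightarrow> ('v \<Rightarrow>\<^sub>0 nat) set" where
  "exps X = {e. Poly_Mapping.keys e \<subseteq> X}"

text \<open>The exponents of the monomials in the Stanley space x^e K[Z].\<close>

definition cone :: "('v \<Rightarrow>\<^sub>0 nat) \<Rightarrow> 'v set \<Rightarrow> ('v \<Rightarrow>\<^sub>0 nat) set" where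
  "cone e Z = (+) e ` exps Z"

text \<open>Used at two levels: on an exponent vector it keeps the variables in \<open>S\<close>, on
  a polynomial it keeps the terms whose exponents lie in \<open>S\<close>.\<close>

definition restr :: "'a set \<Rightarrow> ('a \<Rightarrow>\<^sub>0 'b::zero) \<Rightarrow> 'a \<Rightarrow>\<^sub>0 'b" where
  "restr S f = Poly_Mapping.mapp (\<lambda>k c. c when k \<in> S) f"

lemma lookup_restr: "Poly_Mapping.lookup (restr S f) k = (if k \<in> S then Poly_Mapping.lookup f k else 0)"
  by (auto simp: restr_def lookup_mapp in_keys_iff when_def)

lemma keys_restr: "Poly_Mapping.keys (restr S f) = Poly_Mapping.keys f \<inter> S"
  by (auto simp: in_keys_iff lookup_restr split: if_splits)

lemma exps_iff: "e \<in> exps X \<longleftrightarrow> (\<forall>i. i \<notin> X \<longrightarrow> Poly_Mapping.lookup e i = 0)"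
  by (auto simp: exps_def in_keys_iff)

lemma zero_in_exps: "0 \<in> exps X"
  by (simp add: exps_def)

lemma exps_add: "a \<in> exps X \<Longrightarrow> b \<in> exps X \<Longrightarrow> a + b \<in> exps X"
  by (simp add: exps_iff lookup_add)

lemma exps_mono: "X \<subseteq> Y \<Longrightarrow> exps X \<subseteq> exps Y"
  by (auto simp: exps_def)

lemma exps_empty: "exps {} = {0}"
  by (auto simp: exps_def)

lemma cone_iff:
  "h \<in> cone e Z \<longleftrightarrow>
    (\<forall>i. Poly_Mapping.lookup e i \<le> Poly_Mapping.lookup h i) \<and>
    (\<forall>i. i \<notin> Z \<longrightarrow> Poly_Mapping.lookup h i = Poly_Mapping.lookup e i)"
proof
  assume "h \<in> cone e Z"
  then show "(\<forall>i. Poly_Mapping.lookup e i \<le> Poly_Mapping.lookup h i) \<and>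
    (\<forall>i. i \<notin> Z \<longrightarrow> Poly_Mapping.lookup h i = Poly_Mapping.lookup e i)"
    by (auto simp: cone_def exps_iff lookup_add)
next
  assume a: "(\<forall>i. Poly_Mapping.lookup e i \<le> Poly_Mapping.lookup h i) \<and>
    (\<forall>i. i \<notin> Z \<longrightarrow> Poly_Mapping.lookup h i = Poly_Mapping.lookup e i)"
  \<comment> \<open>Subtraction of exponents is truncated; it is exact here because \<open>e\<close>
    is below \<open>h\<close> in every coordinate.\<close>
  then have "h = e + (h - e)"
    by (intro poly_mapping_eqI) (simp add: lookup_add lookup_minus)
  moreover have "h - e \<in> exps Z"
    using a by (simp add: exps_iff lookup_minus)
  ultimately show "h \<in> cone e Z"
    unfolding cone_def by blast
qed

lemma apex_in_cone: "e \<in> cone e Z"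
  by (simp add: cone_iff)

lemma cone_subset_exps: "e \<in> exps X \<Longrightarrow> Z \<subseteq> X \<Longrightarrow> cone e Z \<subseteq> exps X"
  by (auto simp: cone_def intro!: exps_add dest: exps_mono)

text \<open>The family is indexed by the pairs themselves; as a cone contains its apex, disjointness
  also excludes that two different pairs describe the same cone.\<close>

definition cone_partition ::
    "'v set \<Rightarrow> ('v \<Rightarrow>\<^sub>0 nat) set \<Rightarrow> (('v \<Rightarrow>\<^sub>0 nat) \<times> 'v set) set \<Rightarrow> bool" where
  "cone_partition X E D \<longleftrightarrow>
    finite D \<and> (\<forall>(e, Z)\<in>D. Z \<subseteq> X) \<and> E = (\<Union>(e, Z)\<in>D. cone e Z) \<and>
    disjoint_family_on (\<lambda>(e, Z). cone e Z) D"

lemma cone_partition_disjointD: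
  assumes "cone_partition X E D" "(e, Z) \<in> D" "(f, W) \<in> D" "x \<in> cone e Z" "x \<in> cone f W"
  shows "(e, Z) = (f, W)"
  using assms unfolding cone_partition_def disjoint_family_on_def by fast

text \<open>The bound 0 asserts bare existence. For the empty set every bound holds, by the empty
  partition, so the links to \<open>sdepth\<close> below assume a nonempty set.\<close>

definition has_cone_partition :: "'v set \<Rightarrow> ('v \<Rightarrow>\<^sub>0 nat) set \<Rightarrow> nat \<Rightarrow> bool" where
  "has_cone_partition X E m \<longleftrightarrow> (\<exists>D. cone_partition X E D \<and> (\<forall>(e, Z)\<in>D. m \<le> card Z))"

lemma has_cone_partition_mono:
  assumes "has_cone_partition X E m" "X \<subseteq> Y" "k \<le> m"
  shows "has_cone_partition Y E k"
proof -
  obtain D where "cone_partition X E D" "\<forall>(e, Z)\<in>D. m \<le> card Z"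
    using assms(1) by (auto simp: has_cone_partition_def)
  then have "cone_partition Y E D" "\<forall>(e, Z)\<in>D. k \<le> card Z"
    using assms(2,3) by (fastforce simp: cone_partition_def)+
  then show ?thesis
    unfolding has_cone_partition_def by blast
qed

lemma has_cone_partition_cone:
  assumes "Z \<subseteq> X"
  shows "has_cone_partition X (cone e Z) (card Z)"
  unfolding has_cone_partition_def cone_partition_def
  by (rule exI[of _ "{(e, Z)}"]) (use assms in \<open>auto simp: disjoint_family_on_def\<close>)

lemma has_cone_partition_UN:
  assumes "finite A" "\<And>i. i \<in> A \<Longrightarrow> has_cone_partition X (E i) m" "disjoint_family_on E A"
  shows "has_cone_partition X (\<Union>i\<in>A. E i) m"
proof -
  have "\<forall>i\<in>A. \<exists>D. cone_partition X (E i) D \<and> (\<forall>(e, Z)\<in>D. m \<le> card Z)"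
    using assms(2) by (simp add: has_cone_partition_def)
  then obtain D where D: "\<And>i. i \<in> A \<Longrightarrow> cone_partition X (E i) (D i)"
    and m: "\<And>i. i \<in> A \<Longrightarrow> \<forall>(e, Z)\<in>D i. m \<le> card Z"
    by metis
  have "disjoint_family_on (\<lambda>(e, Z). cone e Z) (\<Union>i\<in>A. D i)"
    unfolding disjoint_family_on_def
  proof (intro ballI impI)
    fix d d' assume d: "d \<in> (\<Union>i\<in>A. D i)" "d' \<in> (\<Union>i\<in>A. D i)" "d \<noteq> d'"
    then obtain i j where ij: "i \<in> A" "d \<in> D i" "j \<in> A" "d' \<in> D j"
      by blast
    show "(case d of (e, Z) \<Rightarrow> cone e Z) \<inter> (case d' of (e, Z) \<Rightarrow> cone e Z) = {}"
    proof (cases "i = j")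
      case True
      then show ?thesis
        using D[OF ij(1)] ij d(3) unfolding cone_partition_def disjoint_family_on_def by blast
    next
      case False
      then have "E i \<inter> E j = {}"
        using assms(3) ij by (auto simp: disjoint_family_on_def)
      moreover have "(case d of (e, Z) \<Rightarrow> cone e Z) \<subseteq> E i" "(case d' of (e, Z) \<Rightarrow> cone e Z) \<subseteq> E j"
        using D[OF ij(1)] D[OF ij(3)] ij unfolding cone_partition_def by blast+
      ultimately show ?thesis by blast
    qed
  qed
  moreover have "(\<Union>i\<in>A. E i) = (\<Union>(e, Z)\<in>(\<Union>i\<in>A. D i). cone e Z)"
    using D unfolding cone_partition_def by (simp add: UN_UN_flatten)
  moreover have "finite (\<Union>i\<in>A. D i)" "\<forall>(e, Z)\<in>(\<Union>i\<in>A. D i). Z \<subseteq> X"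
    using D assms(1) unfolding cone_partition_def by blast+
  ultimately have "cone_partition X (\<Union>i\<in>A. E i) (\<Union>i\<in>A. D i)"
    unfolding cone_partition_def by blast
  then show ?thesis
    using m unfolding has_cone_partition_def by blast
qed

lemma has_cone_partition_Un:
  assumes "has_cone_partition X E m" "has_cone_partition X F m" "E \<inter> F = {}"
  shows "has_cone_partition X (E \<union> F) m"
proof -
  have "has_cone_partition X (\<Union>b\<in>{True, False}. if b then E else F) m"
    by (rule has_cone_partition_UN) (use assms in \<open>auto simp: disjoint_family_on_def\<close>)
  then show ?thesis by (simp add: Un_commute)
qed

lemma exps_disjoint_add_eq:
  assumes "X \<inter> Y = {}" "a \<in> exps X" "a' \<in> exps X" "b \<in> exps Y" "b' \<in> exps Y" "a + b = a' + b'"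
  shows "a = a'" "b = b'"
proof -
  have s: "Poly_Mapping.lookup a i + Poly_Mapping.lookup b i = Poly_Mapping.lookup a' i + Poly_Mapping.lookup b' i" for i
    using assms(6) by (metis lookup_add)
  show "a = a'"
  proof (rule poly_mapping_eqI)
    fix i show "Poly_Mapping.lookup a i = Poly_Mapping.lookup a' i"
    proof (cases "i \<in> X")
      case True
      then have "i \<notin> Y"
        using assms(1) by blast
      then show ?thesis
        using s[of i] assms(4,5) by (simp add: exps_iff)
    next
      case False
      then show ?thesis
        using assms(2,3) by (simp add: exps_iff)
    qed
  qed
  then show "b = b'"
    using assms(6) by simp
qed

text \<open>In disjoint sets of variables the sum of two cones is again a cone, with the union of
  the directions; hence dimensions add. The common shift \<open>w\<close> only moves the
  apexes.\<close>

lemma has_cone_partition_sum: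
  assumes E: "has_cone_partition X E m" "E \<subseteq> exps X"
    and F: "has_cone_partition Y F k" "F \<subseteq> exps Y"
    and XY: "X \<inter> Y = {}" "finite X" "finite Y"
  shows "has_cone_partition (X \<union> Y) {w + a + b |a b. a \<in> E \<and> b \<in> F} (m + k)"
proof -
  obtain C where C: "cone_partition X E C" "\<forall>(e, Z)\<in>C. m \<le> card Z"
    using E by (auto simp: has_cone_partition_def)
  obtain D where D: "cone_partition Y F D" "\<forall>(e, Z)\<in>D. k \<le> card Z"
    using F by (auto simp: has_cone_partition_def)
  define h where "h = (\<lambda>((e::'a \<Rightarrow>\<^sub>0 nat, Z), (f, W)). (w + e + f, Z \<union> W :: 'a set))"
  have cone_h: "cone (w + e + f) (Z \<union> W) = {w + a + b |a b. a \<in> cone e Z \<and> b \<in> cone f W}"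
    if "Z \<subseteq> X" "W \<subseteq> Y" for e f Z W
  proof
    show "cone (w + e + f) (Z \<union> W) \<subseteq> {w + a + b |a b. a \<in> cone e Z \<and> b \<in> cone f W}"
    proof
      fix x assume "x \<in> cone (w + e + f) (Z \<union> W)"
      then obtain v where v: "v \<in> exps (Z \<union> W)" "x = w + e + f + v"
        by (auto simp: cone_def)
      \<comment> \<open>\<open>Z\<close> and \<open>W\<close> are disjoint because \<open>X\<close>
        and \<open>Y\<close> are, so no coordinate is counted twice.\<close>
      have "v = restr Z v + restr W v"
        using v(1) that XY(1) by (intro poly_mapping_eqI) (auto simp: lookup_add lookup_restr exps_iff)
      then have "x = w + (e + restr Z v) + (f + restr W v)"
        using v(2) by (metis add.assoc add.commute)
      moreover have "e + restr Z v \<in> cone e Z" "f + restr W v \<in> cone f W"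
        by (auto simp: cone_def exps_def keys_restr)
      ultimately show "x \<in> {w + a + b |a b. a \<in> cone e Z \<and> b \<in> cone f W}"
        by blast
    qed
    show "{w + a + b |a b. a \<in> cone e Z \<and> b \<in> cone f W} \<subseteq> cone (w + e + f) (Z \<union> W)"
      by (auto simp: cone_iff lookup_add intro!: add_mono)
  qed
  have sub: "\<And>e Z. (e, Z) \<in> C \<Longrightarrow> Z \<subseteq> X" "\<And>e Z. (e, Z) \<in> D \<Longrightarrow> Z \<subseteq> Y"
    "\<And>e Z. (e, Z) \<in> C \<Longrightarrow> cone e Z \<subseteq> E" "\<And>e Z. (e, Z) \<in> D \<Longrightarrow> cone e Z \<subseteq> F"
    using C(1) D(1) unfolding cone_partition_def by blast+
  have disj: "disjoint_family_on (\<lambda>(e, Z). cone e Z) (h ` (C \<times> D))"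
    unfolding disjoint_family_on_def
  proof (intro ballI impI)
    fix p q assume pq: "p \<in> h ` (C \<times> D)" "q \<in> h ` (C \<times> D)" "p \<noteq> q"
    obtain e Z f W where p: "(e, Z) \<in> C" "(f, W) \<in> D" "p = (w + e + f, Z \<union> W)"
      using pq(1) by (auto simp: h_def)
    obtain e' Z' f' W' where q: "(e', Z') \<in> C" "(f', W') \<in> D" "q = (w + e' + f', Z' \<union> W')"
      using pq(2) by (auto simp: h_def)
    show "(case p of (e, Z) \<Rightarrow> cone e Z) \<inter> (case q of (e, Z) \<Rightarrow> cone e Z) = {}"
    proof (rule ccontr)
      assume "\<not> ?thesis"
      then obtain x where "x \<in> cone (w + e + f) (Z \<union> W)" "x \<in> cone (w + e' + f') (Z' \<union> W')"
        using p(3) q(3) by auto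
      then obtain a b a' b' where ab: "x = w + a + b" "a \<in> cone e Z" "b \<in> cone f W"
        "x = w + a' + b'" "a' \<in> cone e' Z'" "b' \<in> cone f' W'"
        using cone_h[OF sub(1)[OF p(1)] sub(2)[OF p(2)], of e f]
          cone_h[OF sub(1)[OF q(1)] sub(2)[OF q(2)], of e' f'] by blast
      then have "a + b = a' + b'"
        by (metis add.assoc add_left_cancel)
      moreover have "a \<in> exps X" "a' \<in> exps X"
        using ab(2,5) sub(3)[OF p(1)] sub(3)[OF q(1)] E(2) by blast+
      moreover have "b \<in> exps Y" "b' \<in> exps Y"
        using ab(3,6) sub(4)[OF p(2)] sub(4)[OF q(2)] F(2) by blast+
      ultimately have "a = a'" "b = b'"
        using exps_disjoint_add_eq[OF XY(1)] by metis+
      then have "(e, Z) = (e', Z')" "(f, W) = (f', W')"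
        using cone_partition_disjointD[OF C(1) p(1) q(1)] cone_partition_disjointD[OF D(1) p(2) q(2)] ab
        by blast+
      then show False
        using p q pq(3) by simp
    qed
  qed
  have "{w + a + b |a b. a \<in> E \<and> b \<in> F} = (\<Union>(e, Z)\<in>h ` (C \<times> D). cone e Z)"
  proof -
    have EF: "E = (\<Union>(e, Z)\<in>C. cone e Z)" "F = (\<Union>(f, W)\<in>D. cone f W)"
      using C(1) D(1) by (simp_all add: cone_partition_def)
    show ?thesis
    proof (intro Set.set_eqI iffI)
      fix x assume "x \<in> {w + a + b |a b. a \<in> E \<and> b \<in> F}"
      then obtain a b where ab: "x = w + a + b" "a \<in> E" "b \<in> F"
        by blast
      obtain e Z where e: "(e, Z) \<in> C" "a \<in> cone e Z"
        using ab(2) EF(1) by auto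
      obtain f W where f: "(f, W) \<in> D" "b \<in> cone f W"
        using ab(3) EF(2) by auto
      have "x \<in> cone (w + e + f) (Z \<union> W)"
        using cone_h[OF sub(1)[OF e(1)] sub(2)[OF f(1)], of e f] ab(1) e(2) f(2) by blast
      moreover have "(w + e + f, Z \<union> W) = h ((e, Z), (f, W))"
        by (simp add: h_def)
      ultimately show "x \<in> (\<Union>(e, Z)\<in>h ` (C \<times> D). cone e Z)"
        using e(1) f(1) by (force simp: h_def)
    next
      fix x assume "x \<in> (\<Union>(e, Z)\<in>h ` (C \<times> D). cone e Z)"
      then obtain e Z f W where e: "(e, Z) \<in> C" and f: "(f, W) \<in> D"
        and x: "x \<in> cone (w + e + f) (Z \<union> W)"
        by (auto simp: h_def)
      then show "x \<in> {w + a + b |a b. a \<in> E \<and> b \<in> F}"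
        using cone_h[OF sub(1)[OF e] sub(2)[OF f], of e f] sub(3)[OF e] sub(4)[OF f] by blast
    qed
  qed
  moreover have "finite (h ` (C \<times> D))"
    using C(1) D(1) unfolding cone_partition_def by simp
  moreover have "\<forall>(e, Z)\<in>h ` (C \<times> D). Z \<subseteq> X \<union> Y"
    unfolding h_def by (auto dest!: sub(1,2))
  ultimately have "cone_partition (X \<union> Y) {w + a + b |a b. a \<in> E \<and> b \<in> F} (h ` (C \<times> D))"
    using disj by (simp add: cone_partition_def)
  moreover have "\<forall>(e, Z)\<in>h ` (C \<times> D). m + k \<le> card Z"
  proof -
    have "m + k \<le> card (Z \<union> W)" if "(e, Z) \<in> C" "(f, W) \<in> D" for e Z f W
    proof -
      have "finite Z" "finite W" "Z \<inter> W = {}"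
        using sub(1)[OF that(1)] sub(2)[OF that(2)] XY by (auto dest: finite_subset)
      then have "card (Z \<union> W) = card Z + card W"
        by (rule card_Un_disjoint)
      then show ?thesis
        using C(2) D(2) that by (auto intro!: add_mono)
    qed
    then show ?thesis
      by (auto simp: h_def)
  qed
  ultimately show ?thesis
    unfolding has_cone_partition_def by blast
qed

section \<open>Existence of cone partitions by truncation of exponents\<close>

lemma finite_bounded_exps:
  assumes "finite X"
  shows "finite {e \<in> exps X. \<forall>i. Poly_Mapping.lookup e i \<le> N}"
proof (rule inj_on_finite)
  show "inj_on (\<lambda>e. restrict (Poly_Mapping.lookup e) X) {e \<in> exps X. \<forall>i. Poly_Mapping.lookup e i \<le> N}"
  proof (rule inj_onI, rule poly_mapping_eqI)
    fix e f i
    assume ef: "e \<in> {e \<in> exps X. \<forall>i. Poly_Mapping.lookup e i \<le> N}"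
      "f \<in> {e \<in> exps X. \<forall>i. Poly_Mapping.lookup e i \<le> N}"
      "restrict (Poly_Mapping.lookup e) X = restrict (Poly_Mapping.lookup f) X"
    show "Poly_Mapping.lookup e i = Poly_Mapping.lookup f i"
      using fun_cong[OF ef(3), of i] ef(1,2) by (cases "i \<in> X") (auto simp: exps_iff)
  qed
  show "(\<lambda>e. restrict (Poly_Mapping.lookup e) X) ` {e \<in> exps X. \<forall>i. Poly_Mapping.lookup e i \<le> N}
      \<subseteq> X \<rightarrow>\<^sub>E {..N}"
    by auto
  show "finite (X \<rightarrow>\<^sub>E {..N})"
    using assms by (intro finite_PiE) auto
qed

lemma lookup_map_min: "Poly_Mapping.lookup (Poly_Mapping.map (min N) e) i = min N (Poly_Mapping.lookup e i)"
  for e :: "'v \<Rightarrow>\<^sub>0 nat"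
  by (simp add: Poly_Mapping.map.rep_eq when_def)

text \<open>The vectors with a given truncation \<open>t\<close> form a cone: apex \<open>t\<close>,
  free exactly in the directions where \<open>t\<close> has reached \<open>N\<close>. An invariant
  set is the union of the cones of its finitely many truncated vectors. Nothing is claimed about
  dimensions; the result only provides some decomposition.\<close>

lemma has_cone_partition_truncation_invariant:
  assumes X: "finite X" and E: "E \<subseteq> exps X"
    and inv: "\<And>e. e \<in> exps X \<Longrightarrow> e \<in> E \<longleftrightarrow> Poly_Mapping.map (min N) e \<in> E"
  shows "has_cone_partition X E 0"
proof -
  define T where "T = {t \<in> E. \<forall>i. Poly_Mapping.lookup t i \<le> N}"
  define h where "h t = (t, {i \<in> X. Poly_Mapping.lookup t i = N})" for t
  have cone_h: "x \<in> cone t {i \<in> X. Poly_Mapping.lookup t i = N} \<longleftrightarrow> x \<in> exps X \<and> t = Poly_Mapping.map (min N) x"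
    if t: "t \<in> T" for t x
  proof
    assume x: "x \<in> cone t {i \<in> X. Poly_Mapping.lookup t i = N}"
    have "t \<in> exps X"
      using t E by (auto simp: T_def)
    then have "x \<in> exps X"
      using x cone_subset_exps[of t X "{i \<in> X. Poly_Mapping.lookup t i = N}"] by auto
    moreover have "Poly_Mapping.lookup t i = min N (Poly_Mapping.lookup x i)" for i
    proof (cases "i \<in> X \<and> Poly_Mapping.lookup t i = N")
      case True
      then show ?thesis
        using x unfolding cone_iff by (metis min.absorb1)
    next
      case False
      then have "Poly_Mapping.lookup x i = Poly_Mapping.lookup t i"
        using x unfolding cone_iff by blast
      then show ?thesis
        using t by (simp add: T_def)
    qed
    ultimately show "x \<in> exps X \<and> t = Poly_Mapping.map (min N) x"
      by (auto intro!: poly_mapping_eqI simp: lookup_map_min)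
  next
    assume x: "x \<in> exps X \<and> t = Poly_Mapping.map (min N) x"
    then show "x \<in> cone t {i \<in> X. Poly_Mapping.lookup t i = N}"
      by (auto simp: cone_iff lookup_map_min exps_iff min_def)
  qed
  have "T \<subseteq> {e \<in> exps X. \<forall>i. Poly_Mapping.lookup e i \<le> N}"
    using E by (auto simp: T_def)
  then have "finite T"
    by (rule finite_subset) (rule finite_bounded_exps[OF X])
  moreover have "disjoint_family_on (\<lambda>(e, Z). cone e Z) (h ` T)"
    unfolding disjoint_family_on_def h_def using cone_h by auto
  moreover have "E = (\<Union>(e, Z)\<in>h ` T. cone e Z)"
  proof
    show "E \<subseteq> (\<Union>(e, Z)\<in>h ` T. cone e Z)"
    proof
      fix x assume x: "x \<in> E"
      then have "Poly_Mapping.map (min N) x \<in> T"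
        using inv E by (auto simp: T_def lookup_map_min)
      then show "x \<in> (\<Union>(e, Z)\<in>h ` T. cone e Z)"
        using cone_h x E by (auto simp: h_def intro!: bexI[of _ "Poly_Mapping.map (min N) x"])
    qed
    show "(\<Union>(e, Z)\<in>h ` T. cone e Z) \<subseteq> E"
      using cone_h inv by (auto simp: h_def T_def)
  qed
  ultimately have "cone_partition X E (h ` T)"
    by (auto simp: cone_partition_def h_def)
  then show ?thesis
    unfolding has_cone_partition_def by auto
qed

section \<open>Multigraded modules with a basis of monomials\<close>

lemma Ex1_unique: "\<exists>!x. P x \<Longrightarrow> P a \<Longrightarrow> P b \<Longrightarrow> a = b"
  by blast

text \<open>The K-span of the monomials with exponents in \<open>A\<close>. Polynomial rings,
  monomial ideals and Stanley spaces inside them all take this form, so questions about them become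
  questions about sets of exponents.\<close>

definition polys :: "('v \<Rightarrow>\<^sub>0 nat) set \<Rightarrow> ('v, 'k::field) mpol set" where
  "polys A = {p. Poly_Mapping.keys p \<subseteq> A}"

lemma polys_iff: "p \<in> polys A \<longleftrightarrow> (\<forall>e. e \<notin> A \<longrightarrow> Poly_Mapping.lookup p e = 0)"
  by (auto simp: polys_def in_keys_iff)

lemma carrier_poly_ring: "carrier (poly_ring X) = polys (exps X)"
  by (simp add: poly_ring_def polys_def exps_def subset_eq)

lemma poly_ring_ops [simp]:
  "p \<otimes>\<^bsub>poly_ring X\<^esub> q = p * q" "\<one>\<^bsub>poly_ring X\<^esub> = 1"
  "\<zero>\<^bsub>poly_ring X\<^esub> = 0" "p \<oplus>\<^bsub>poly_ring X\<^esub> q = p + q"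
  by (simp_all add: poly_ring_def)

lemma polys_zero: "0 \<in> polys A"
  by (simp add: polys_def)

lemma polys_add: "p \<in> polys A \<Longrightarrow> q \<in> polys A \<Longrightarrow> p + q \<in> polys A"
  by (simp add: polys_iff lookup_add)

lemma polys_uminus: "p \<in> polys A \<Longrightarrow> - p \<in> polys A"
  by (simp add: polys_iff)

lemma polys_sum: "(\<And>d. d \<in> D \<Longrightarrow> g d \<in> polys A) \<Longrightarrow> sum g D \<in> polys A"
  by (simp add: polys_iff lookup_sum)

lemma polys_mono: "A \<subseteq> B \<Longrightarrow> polys A \<subseteq> polys B"
  by (auto simp: polys_def)

lemma polys_restr: "restr A p \<in> polys A"
  by (simp add: polys_def keys_restr)

lemma polys_single: "e \<in> A \<Longrightarrow> Poly_Mapping.single e c \<in> polys A"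
  by (simp add: polys_def)

lemma polys_mult:
  assumes "p \<in> polys A" "q \<in> polys B" "\<And>a b. a \<in> A \<Longrightarrow> b \<in> B \<Longrightarrow> a + b \<in> C"
  shows "p * q \<in> polys C"
  using assms keys_mult[of p q] unfolding polys_def by blast

lemma poly_mapping_sum_single:
  "p = (\<Sum>e\<in>Poly_Mapping.keys p. Poly_Mapping.single e (Poly_Mapping.lookup p e))"
  by (rule poly_mapping_eqI) (auto simp: lookup_sum lookup_single when_def in_keys_iff)

text \<open>Multiplication by a term merely shifts coefficients; this allows cancelling a monomial
  and testing a colon ideal coefficient by coefficient.\<close>

lemma lookup_mult_single:
  fixes p :: "('v, 'k::field) mpol"
  shows "Poly_Mapping.lookup (p * Poly_Mapping.single e c) (v + e) = Poly_Mapping.lookup p v * c"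
proof -
  have "p * Poly_Mapping.single e c =
    (\<Sum>h\<in>Poly_Mapping.keys p. Poly_Mapping.single (h + e) (Poly_Mapping.lookup p h * c))"
    by (subst poly_mapping_sum_single[of p]) (simp add: sum_distrib_right mult_single)
  then show ?thesis
    by (auto simp: lookup_sum lookup_single when_def in_keys_iff)
qed

text \<open>The scalar is kept because the homogeneous generator of a Stanley space is a monomial
  only up to a nonzero constant.\<close>

lemma polys_cone_eq:
  assumes "c \<noteq> 0"
  shows "polys (cone e Z) = (\<lambda>p. p * Poly_Mapping.single e (c::'k::field)) ` polys (exps Z)"
proof
  show "(\<lambda>p. p * Poly_Mapping.single e c) ` polys (exps Z) \<subseteq> polys (cone e Z)"
    by (auto intro!: polys_mult[where B = "{e}"] polys_single simp: cone_def add.commute)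
  show "polys (cone e Z) \<subseteq> (\<lambda>p. p * Poly_Mapping.single e c) ` polys (exps Z)"
  proof
    fix f :: "('a, 'k) mpol" assume "f \<in> polys (cone e Z)"
    then have "\<forall>h\<in>Poly_Mapping.keys f. \<exists>v\<in>exps Z. h = e + v"
      by (auto simp: polys_def cone_def)
    then obtain v where v: "\<And>h. h \<in> Poly_Mapping.keys f \<Longrightarrow> v h \<in> exps Z"
      "\<And>h. h \<in> Poly_Mapping.keys f \<Longrightarrow> v h + e = h"
      by (metis add.commute)
    define p where "p = (\<Sum>h\<in>Poly_Mapping.keys f. Poly_Mapping.single (v h) (Poly_Mapping.lookup f h / c))"
    have "p * Poly_Mapping.single e c =
      (\<Sum>h\<in>Poly_Mapping.keys f. Poly_Mapping.single h (Poly_Mapping.lookup f h))"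
      unfolding p_def sum_distrib_right using assms v(2) by (intro sum.cong) (simp_all add: mult_single)
    then have "f = p * Poly_Mapping.single e c"
      using poly_mapping_sum_single[of f] by simp
    moreover have "p \<in> polys (exps Z)"
      unfolding p_def using v(1) by (intro polys_sum polys_single)
    ultimately show "f \<in> (\<lambda>p. p * Poly_Mapping.single e c) ` polys (exps Z)"
      by blast
  qed
qed

text \<open>
  The locale describes a multigraded module isomorphic to the quotient of the span of the monomials
  with exponents in \<open>A\<close> by the span of those with exponents in \<open>A - E\<close>: the images of the monomials
  with exponents in \<open>E\<close> are a basis over the field.
\<close>

locale monomial_subquotient =
  fixes X :: "'v set" and A E :: "('v \<Rightarrow>\<^sub>0 nat) set"
    and M :: "(('v, 'k::field) mpol, 'b, 'v) graded_module"
    and \<pi> :: "('v, 'k) mpol \<Rightarrow> 'b"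
  assumes finite_vars: "finite X"
    and A_subset: "A \<subseteq> exps X"
    and E_subset: "E \<subseteq> A"
    and A_closed: "\<And>a v. a \<in> A \<Longrightarrow> v \<in> exps X \<Longrightarrow> v + a \<in> A"
    and A_minus_E_closed: "\<And>a v. a \<in> A - E \<Longrightarrow> v \<in> exps X \<Longrightarrow> v + a \<in> A - E"
    and carrier_eq: "carrier M = \<pi> ` polys A"
    and pi_eq_iff: "\<And>f g. f \<in> polys A \<Longrightarrow> g \<in> polys A \<Longrightarrow>
      \<pi> f = \<pi> g \<longleftrightarrow> (\<forall>e\<in>E. Poly_Mapping.lookup f e = Poly_Mapping.lookup g e)"
    and pi_add: "\<And>f g. f \<in> polys A \<Longrightarrow> g \<in> polys A \<Longrightarrow> \<pi> f \<oplus>\<^bsub>M\<^esub> \<pi> g = \<pi> (f + g)"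
    and pi_zero: "\<zero>\<^bsub>M\<^esub> = \<pi> 0"
    and pi_smult: "\<And>p f. p \<in> polys (exps X) \<Longrightarrow> f \<in> polys A \<Longrightarrow> p \<odot>\<^bsub>M\<^esub> \<pi> f = \<pi> (p * f)"
    and component_eq: "\<And>g. component M g = \<pi> ` {f \<in> polys A. has_degree f g}"
begin

text \<open>Sums are taken both in the whole module and in modules whose carrier is cut down to one
  span. A general \<open>B\<close> covers both: \<open>B = A\<close> gives \<open>M\<close> itself,
  a cone gives a Stanley space.\<close>

lemma abelian_monoid_image:
  assumes "B \<subseteq> A"
  shows "abelian_monoid (M\<lparr>carrier := \<pi> ` polys B\<rparr>)"
proof -
  have BA: "p \<in> polys B \<Longrightarrow> p \<in> polys A" for p
    using polys_mono[OF assms] by blast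
  show ?thesis
    by (rule abelian_monoidI)
      (auto simp: pi_zero pi_add BA polys_zero polys_add ac_simps)
qed

lemma finsum_image:
  assumes "B \<subseteq> A" "finite D" "\<And>d. d \<in> D \<Longrightarrow> f d = \<pi> (g d)" "\<And>d. d \<in> D \<Longrightarrow> g d \<in> polys B"
  shows "(\<Oplus>\<^bsub>M\<lparr>carrier := \<pi> ` polys B\<rparr>\<^esub>d\<in>D. f d) = \<pi> (\<Sum>d\<in>D. g d)"
proof -
  interpret abelian_monoid "M\<lparr>carrier := \<pi> ` polys B\<rparr>"
    using assms(1) by (rule abelian_monoid_image)
  show ?thesis
    using assms(2-)
  proof (induction D)
    case empty
    then show ?case
      by (simp add: pi_zero)
  next
    case (insert d D)
    have "f \<in> D \<rightarrow> \<pi> ` polys B" "f d \<in> \<pi> ` polys B"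
      using insert.prems by auto
    moreover have "sum g D \<in> polys A" "g d \<in> polys A"
      using insert.prems polys_mono[OF assms(1)] by (auto intro!: polys_sum)
    ultimately show ?case
      using insert by (simp add: finsum_insert pi_add)
  qed
qed

lemma finsum_pi:
  assumes "finite D" "\<And>d. d \<in> D \<Longrightarrow> f d = \<pi> (g d)" "\<And>d. d \<in> D \<Longrightarrow> g d \<in> polys A"
  shows "(\<Oplus>\<^bsub>M\<^esub>d\<in>D. f d) = \<pi> (\<Sum>d\<in>D. g d)"
  using finsum_image[of A D f g] assms by (simp add: carrier_eq[symmetric])

section \<open>Stanley spaces correspond to cones inside the monomial basis\<close>

lemma pi_inj:
  assumes "f \<in> polys B" "g \<in> polys B" "B \<subseteq> E" "\<pi> f = \<pi> g"
  shows "f = g"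
proof (rule poly_mapping_eqI)
  fix e
  have "f \<in> polys A" "g \<in> polys A"
    using assms polys_mono E_subset by blast+
  then show "Poly_Mapping.lookup f e = Poly_Mapping.lookup g e"
    using assms pi_eq_iff[of f g] by (cases "e \<in> E") (auto simp: polys_iff subset_eq)
qed

lemma cone_subset_A: "e \<in> A \<Longrightarrow> Z \<subseteq> X \<Longrightarrow> cone e Z \<subseteq> A"
  using exps_mono by (auto simp: cone_def add.commute intro!: A_closed)

lemma span_space_single:
  assumes "e \<in> A" "c \<noteq> 0" "Z \<subseteq> X"
  shows "span_space M (\<pi> (Poly_Mapping.single e c)) Z = \<pi> ` polys (cone e Z)"
proof -
  have "p \<odot>\<^bsub>M\<^esub> \<pi> (Poly_Mapping.single e c) = \<pi> (p * Poly_Mapping.single e c)"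
    if "p \<in> polys (exps Z)" for p
    using that polys_mono[OF exps_mono[OF assms(3)]] assms(1) by (intro pi_smult polys_single) auto
  then show ?thesis
    unfolding span_space_def carrier_poly_ring polys_cone_eq[OF assms(2)] image_image
    by (auto simp: image_iff) metis+
qed

text \<open>A degree determines the exponent vector, as \<open>int\<close> is injective, so a
  representative of one degree has at most one term. A nonzero class needs a nonzero coefficient at
  some exponent in \<open>E\<close>.\<close>

lemma homogeneous_eq_single:
  assumes "homogeneous X M u" "u \<noteq> \<zero>\<^bsub>M\<^esub>"
  obtains e c where "e \<in> E" "c \<noteq> 0" "u = \<pi> (Poly_Mapping.single e c)"
proof -
  obtain g f where f: "f \<in> polys A" "has_degree f g" "u = \<pi> f"
    using assms(1) by (auto simp: homogeneous_def component_eq)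
  then obtain e where e: "e \<in> E" "Poly_Mapping.lookup f e \<noteq> 0"
    using assms(2) pi_eq_iff[OF f(1) polys_zero] by (auto simp: pi_zero)
  have "h = e" if "h \<in> Poly_Mapping.keys f" for h
  proof (rule poly_mapping_eqI)
    fix i
    have "Poly_Mapping.map int h = Poly_Mapping.map int e"
      using f(2) that e(2) by (simp add: has_degree_def in_keys_iff)
    then have "Poly_Mapping.lookup (Poly_Mapping.map int h) i = Poly_Mapping.lookup (Poly_Mapping.map int e) i"
      by simp
    then show "Poly_Mapping.lookup h i = Poly_Mapping.lookup e i"
      by (simp add: Poly_Mapping.map.rep_eq when_def split: if_splits)
  qed
  then have "f = Poly_Mapping.single e (Poly_Mapping.lookup f e)"
    by (intro poly_mapping_eqI) (auto simp: lookup_single when_def in_keys_iff)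
  then show ?thesis
    using that e f(3) by metis
qed

text \<open>The generator alone is a basis: a cone inside \<open>E\<close> meets no killed monomial,
  so \<open>\<pi>\<close> is injective on its span and the coefficient is recovered by cancelling
  \<open>mono e\<close>.\<close>

lemma stanley_space_mono:
  assumes "e \<in> E" "Z \<subseteq> X" "cone e Z \<subseteq> E"
  shows "stanley_space X M (\<pi> (mono e)) Z"
proof -
  let ?u = "\<pi> (mono e)"
  let ?N = "M\<lparr>carrier := span_space M ?u Z\<rparr>"
  have eA: "e \<in> A"
    using assms E_subset by blast
  have eX: "Poly_Mapping.keys e \<subseteq> X"
    using eA A_subset by (auto simp: exps_def)
  have span: "span_space M ?u Z = \<pi> ` polys (cone e Z)"
    unfolding mono_def using eA assms by (intro span_space_single) auto
  have me: "mono e \<in> polys A" "mono e \<in> polys (cone e Z)"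
    using eA by (simp_all add: mono_def polys_single apex_in_cone)
  have deg: "has_degree (mono e :: ('v, 'k) mpol) (Poly_Mapping.map int e)"
    by (simp add: has_degree_def mono_def)
  have "Poly_Mapping.keys (Poly_Mapping.map int e) \<subseteq> X"
    using eX by (auto simp: in_keys_iff Poly_Mapping.map.rep_eq when_def split: if_splits)
  then have hom: "homogeneous X M ?u"
    unfolding homogeneous_def component_eq using me(1) deg by blast
  have cone_A: "cone e Z \<subseteq> A"
    using assms E_subset by blast
  have smult: "p \<odot>\<^bsub>M\<^esub> ?u = \<pi> (p * mono e)" "p * mono e \<in> polys (cone e Z)" if "p \<in> polys (exps Z)" for p
  proof -
    show "p \<odot>\<^bsub>M\<^esub> ?u = \<pi> (p * mono e)"
      using that polys_mono[OF exps_mono[OF assms(2)]] me(1) by (intro pi_smult) auto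
    show "p * mono e \<in> polys (cone e Z)"
      using that polys_cone_eq[of "1::'k" e Z] by (auto simp: mono_def)
  qed
  \<comment> \<open>The index set of the sum is empty when the coefficient is zero and a singleton
    otherwise; both cases are given by the same formula.\<close>
  have lin: "(\<Oplus>\<^bsub>?N\<^esub>b\<in>{b \<in> {?u}. c b \<noteq> \<zero>\<^bsub>poly_ring Z\<^esub>}. c b \<odot>\<^bsub>?N\<^esub> b) = \<pi> (c ?u * mono e)"
    if c: "c \<in> {?u} \<rightarrow>\<^sub>E carrier (poly_ring Z)" for c
  proof -
    have "c ?u \<in> polys (exps Z)"
      using c by (auto simp: carrier_poly_ring)
    then have "(\<Oplus>\<^bsub>?N\<^esub>b\<in>{b \<in> {?u}. c b \<noteq> \<zero>\<^bsub>poly_ring Z\<^esub>}. c b \<odot>\<^bsub>?N\<^esub> b) =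
      \<pi> (\<Sum>b\<in>{b \<in> {?u}. c b \<noteq> \<zero>\<^bsub>poly_ring Z\<^esub>}. c b * mono e)"
      unfolding span using cone_A smult by (intro finsum_image) auto
    also have "(\<Sum>b\<in>{b \<in> {?u}. c b \<noteq> \<zero>\<^bsub>poly_ring Z\<^esub>}. c b * mono e) = c ?u * mono e"
      by (cases "c ?u = 0") (auto simp: Collect_conv_if)
    finally show ?thesis .
  qed
  have "free_module (poly_ring Z :: ('v, 'k) mpol ring) ?N"
    unfolding free_module_def
  proof (intro exI[of _ "{?u}"] conjI ballI)
    show "{?u} \<subseteq> carrier ?N"
      using me(2) by (auto simp: span)
    fix y assume "y \<in> carrier ?N"
    then have "y \<in> \<pi> ` polys (cone e Z)"
      by (simp add: span)
    then obtain p where p: "p \<in> polys (exps Z)" "y = \<pi> (p * mono e)"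
      unfolding polys_cone_eq[of "1::'k" e Z, simplified] mono_def by blast
    show "\<exists>!c. c \<in> {?u} \<rightarrow>\<^sub>E carrier (poly_ring Z) \<and> finite {b \<in> {?u}. c b \<noteq> \<zero>\<^bsub>poly_ring Z\<^esub>} \<and>
        y = (\<Oplus>\<^bsub>?N\<^esub>b\<in>{b \<in> {?u}. c b \<noteq> \<zero>\<^bsub>poly_ring Z\<^esub>}. c b \<odot>\<^bsub>?N\<^esub> b)"
    proof (rule ex1I[of _ "\<lambda>b\<in>{?u}. p"])
      have c: "(\<lambda>b\<in>{?u}. p) \<in> {?u} \<rightarrow>\<^sub>E carrier (poly_ring Z)"
        using p(1) by (auto simp: carrier_poly_ring)
      show "(\<lambda>b\<in>{?u}. p) \<in> {?u} \<rightarrow>\<^sub>E carrier (poly_ring Z) \<and>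
          finite {b \<in> {?u}. (\<lambda>b\<in>{?u}. p) b \<noteq> \<zero>\<^bsub>poly_ring Z\<^esub>} \<and>
          y = (\<Oplus>\<^bsub>?N\<^esub>b\<in>{b \<in> {?u}. (\<lambda>b\<in>{?u}. p) b \<noteq> \<zero>\<^bsub>poly_ring Z\<^esub>}. (\<lambda>b\<in>{?u}. p) b \<odot>\<^bsub>?N\<^esub> b)"
        unfolding lin[OF c] using c p(2) by simp
      fix c assume "c \<in> {?u} \<rightarrow>\<^sub>E carrier (poly_ring Z) \<and>
          finite {b \<in> {?u}. c b \<noteq> \<zero>\<^bsub>poly_ring Z\<^esub>} \<and>
          y = (\<Oplus>\<^bsub>?N\<^esub>b\<in>{b \<in> {?u}. c b \<noteq> \<zero>\<^bsub>poly_ring Z\<^esub>}. c b \<odot>\<^bsub>?N\<^esub> b)"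
      then have c: "c \<in> {?u} \<rightarrow>\<^sub>E carrier (poly_ring Z)" and "\<pi> (p * mono e) = \<pi> (c ?u * mono e)"
        using lin[of c] p(2) by auto
      moreover have cp: "c ?u \<in> polys (exps Z)"
        using c by (auto simp: carrier_poly_ring)
      ultimately have "p * mono e = c ?u * mono e"
        using smult(2)[OF p(1)] smult(2)[OF cp] pi_inj assms(3) by blast
      then have "Poly_Mapping.lookup p v = Poly_Mapping.lookup (c ?u) v" for v
        using lookup_mult_single[of p e 1 v] lookup_mult_single[of "c ?u" e 1 v] by (simp add: mono_def)
      then have "c ?u = p"
        by (intro poly_mapping_eqI) simp
      then show "c = (\<lambda>b\<in>{?u}. p)"
        using c by (intro PiE_ext[OF c]) auto
    qed
  qed
  then show ?thesis
    unfolding stanley_space_def using me(1) hom assms(2) by (auto simp: carrier_eq)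
qed

text \<open>If the cone left \<open>E\<close> at \<open>v + e\<close>, multiplication by
  \<open>mono v\<close> would annihilate the whole span, hence also a member of the basis that
  freeness provides, and zero would have two different expansions.\<close>

lemma stanley_space_cone:
  assumes "stanley_space X M u Z" "u \<noteq> \<zero>\<^bsub>M\<^esub>"
  shows "\<exists>e\<in>E. cone e Z \<subseteq> E \<and> span_space M u Z = \<pi> ` polys (cone e Z)"
proof -
  let ?N = "M\<lparr>carrier := span_space M u Z\<rparr>"
  have ZX: "Z \<subseteq> X" and "homogeneous X M u" and free: "free_module (poly_ring Z :: ('v, 'k) mpol ring) ?N"
    using assms(1) by (simp_all add: stanley_space_def)
  then obtain e c where e: "e \<in> E" "c \<noteq> 0" "u = \<pi> (Poly_Mapping.single e c)"
    using homogeneous_eq_single assms(2) by metis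
  have eA: "e \<in> A"
    using e(1) E_subset by blast
  have span: "span_space M u Z = \<pi> ` polys (cone e Z)"
    unfolding e(3) using eA e(2) ZX by (rule span_space_single)
  have cone_A: "cone e Z \<subseteq> A"
    using eA ZX by (rule cone_subset_A)
  interpret N: abelian_monoid ?N
    unfolding span using cone_A by (rule abelian_monoid_image)
  have "u \<in> \<pi> ` polys (cone e Z)"
    unfolding e(3) by (intro imageI polys_single apex_in_cone)
  then have u_span: "u \<in> carrier ?N"
    by (simp add: span)
  obtain B where basis: "B \<subseteq> carrier ?N \<and> (\<forall>y\<in>carrier ?N.
      \<exists>!c. c \<in> B \<rightarrow>\<^sub>E carrier (poly_ring Z :: ('v, 'k) mpol ring) \<and> finite {b\<in>B. c b \<noteq> \<zero>\<^bsub>poly_ring Z\<^esub>} \<and>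
           y = (\<Oplus>\<^bsub>?N\<^esub>b\<in>{b\<in>B. c b \<noteq> \<zero>\<^bsub>poly_ring Z\<^esub>}. c b \<odot>\<^bsub>?N\<^esub> b))"
    using free unfolding free_module_def by (elim exE) (rule that)
  note B = basis[THEN conjunct1] and basis = basis[THEN conjunct2, THEN bspec]
  \<comment> \<open>Over an empty basis every element would be the empty sum, contrary to
    \<open>u\<close> being nonzero.\<close>
  have "B \<noteq> {}"
  proof
    assume "B = {}"
    then have "u = \<zero>\<^bsub>?N\<^esub>"
      using basis[OF u_span] by auto
    then show False
      using assms(2) by simp
  qed
  then obtain b where b: "b \<in> B"
    by blast
  then have "b \<in> \<pi> ` polys (cone e Z)"
    using B by (auto simp: span)
  then obtain p where p: "p \<in> polys (exps Z)" "b = \<pi> (p * Poly_Mapping.single e c)"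
    unfolding polys_cone_eq[OF e(2)] by blast
  have "cone e Z \<subseteq> E"
  proof (rule ccontr)
    assume "\<not> cone e Z \<subseteq> E"
    then obtain v where v: "v \<in> exps Z" "v + e \<notin> E"
      by (auto simp: cone_def add.commute)
    then have vX: "v \<in> exps X"
      using exps_mono[OF ZX] by blast
    have "p \<in> polys (exps X)"
      using p(1) polys_mono[OF exps_mono[OF ZX]] by blast
    have "v + e \<in> A - E"
      using v(2) A_closed[OF eA vX] by blast
    \<comment> \<open>\<open>b\<close> comes from a multiple of the term at \<open>e\<close>; after
      multiplication by \<open>mono v\<close> all exponents lie in \<open>A - E\<close>, where
      \<open>\<pi>\<close> vanishes.\<close>
    have kill: "mono v \<odot>\<^bsub>?N\<^esub> b = \<zero>\<^bsub>?N\<^esub>"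
    proof -
      have "p * Poly_Mapping.single e c \<in> polys A"
        using \<open>p \<in> polys (exps X)\<close> A_closed by (rule polys_mult[OF _ polys_single[OF eA]]) auto
      moreover have "(mono v :: ('v, 'k) mpol) \<in> polys (exps X)"
        using vX by (simp add: mono_def polys_single)
      ultimately have "mono v \<odot>\<^bsub>?N\<^esub> b = \<pi> (mono v * (p * Poly_Mapping.single e c))"
        by (simp add: p(2) pi_smult)
      also have "mono v * (p * Poly_Mapping.single e c) = p * Poly_Mapping.single (v + e) c"
        by (simp add: mono_def mult.left_commute[of _ p] mult_single)
      also have "\<pi> (p * Poly_Mapping.single (v + e) c) = \<pi> 0"
      proof -
        have "p * Poly_Mapping.single (v + e) c \<in> polys (A - E)"
          using \<open>p \<in> polys (exps X)\<close> A_minus_E_closed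
          by (rule polys_mult[OF _ polys_single[OF \<open>v + e \<in> A - E\<close>]]) auto
        then show ?thesis
          using polys_mono[of "A - E" A] by (subst pi_eq_iff) (auto simp: polys_iff)
      qed
      finally show ?thesis
        by (simp add: pi_zero)
    qed
    let ?P = "\<lambda>c. c \<in> B \<rightarrow>\<^sub>E carrier (poly_ring Z :: ('v, 'k) mpol ring) \<and> finite {b\<in>B. c b \<noteq> \<zero>\<^bsub>poly_ring Z\<^esub>} \<and>
           \<zero>\<^bsub>?N\<^esub> = (\<Oplus>\<^bsub>?N\<^esub>b\<in>{b\<in>B. c b \<noteq> \<zero>\<^bsub>poly_ring Z\<^esub>}. c b \<odot>\<^bsub>?N\<^esub> b)"
    \<comment> \<open>Two coordinate families for zero: the zero family, and the one whose only
      nonzero entry is \<open>mono v\<close> at \<open>b\<close>.\<close>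
    let ?c0 = "\<lambda>x\<in>B. 0 :: ('v, 'k) mpol" and ?c1 = "\<lambda>x\<in>B. if x = b then mono v else 0 :: ('v, 'k) mpol"
    have mv: "(mono v :: ('v, 'k) mpol) \<in> polys (exps Z)" "(mono v :: ('v, 'k) mpol) \<noteq> 0"
      using v(1) by (simp_all add: mono_def polys_single) (metis lookup_single_eq lookup_zero one_neq_zero)
    have "{x\<in>B. ?c0 x \<noteq> \<zero>\<^bsub>poly_ring Z\<^esub>} = {}"
      by auto
    then have "?P ?c0"
      by (simp add: carrier_poly_ring polys_zero)
    moreover have "?P ?c1"
    proof -
      have s: "{x\<in>B. ?c1 x \<noteq> \<zero>\<^bsub>poly_ring Z\<^esub>} = {b}"
        using b mv(2) by auto
      have "(\<Oplus>\<^bsub>?N\<^esub>x\<in>{b}. ?c1 x \<odot>\<^bsub>?N\<^esub> x) = (\<Oplus>\<^bsub>?N\<^esub>x\<in>{b}. \<zero>\<^bsub>?N\<^esub>)"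
        using b kill N.zero_closed by (intro N.finsum_cong') (auto simp del: N.zero_closed)
      also have "\<dots> = \<zero>\<^bsub>?N\<^esub>"
        by (rule N.finsum_zero)
      finally show ?thesis
        unfolding s using mv(1) by (auto simp: carrier_poly_ring polys_zero)
    qed
    ultimately have "?c0 = ?c1"
      by (rule Ex1_unique[OF basis[OF N.zero_closed]])
    then have "?c0 b = ?c1 b"
      by (rule fun_cong)
    then show False
      using b mv(2) by simp
  qed
  then show ?thesis
    using e(1) span by blast
qed


text \<open>Disjointness lets the coefficients of a sum at the exponents in \<open>C d\<close>
  determine its component \<open>d\<close>. Coefficients outside \<open>E\<close> are invisible to
  \<open>\<pi>\<close>, so agreement on \<open>E\<close> suffices.\<close>

lemma direct_sum:
  assumes D: "finite D" and disj: "disjoint_family_on C D" and C: "(\<Union>d\<in>D. C d) = E"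
    and y: "y \<in> carrier M"
  shows "\<exists>!f. f \<in> (\<Pi>\<^sub>E d\<in>D. \<pi> ` polys (C d)) \<and> y = (\<Oplus>\<^bsub>M\<^esub>d\<in>D. f d)"
proof -
  obtain q where q: "q \<in> polys A" "y = \<pi> q"
    using y by (auto simp: carrier_eq)
  have CA: "polys (C d) \<subseteq> (polys A :: ('v, 'k) mpol set)" if "d \<in> D" for d
    using that C E_subset by (intro polys_mono) blast
  have lookup_sum_cone: "Poly_Mapping.lookup (\<Sum>d\<in>D. g d) e = Poly_Mapping.lookup (g d) e"
    if "\<And>d. d \<in> D \<Longrightarrow> g d \<in> polys (C d)" "d \<in> D" "e \<in> C d" for g :: "_ \<Rightarrow> ('v, 'k) mpol" and d e
  proof -
    have "Poly_Mapping.lookup (g d') e = 0" if "d' \<in> D - {d}" for d'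
      using that \<open>d \<in> D\<close> \<open>e \<in> C d\<close> disj \<open>\<And>d. d \<in> D \<Longrightarrow> g d \<in> polys (C d)\<close>[of d']
      by (auto simp: disjoint_family_on_def polys_iff)
    then show ?thesis
      using \<open>d \<in> D\<close> D by (simp add: sum.remove lookup_add) (simp add: lookup_sum)
  qed
  show ?thesis
  proof (rule ex1I[of _ "\<lambda>d\<in>D. \<pi> (restr (C d) q)"])
    have "(\<Oplus>\<^bsub>M\<^esub>d\<in>D. (\<lambda>d\<in>D. \<pi> (restr (C d) q)) d) = \<pi> (\<Sum>d\<in>D. restr (C d) q)"
      using D CA polys_restr by (intro finsum_pi) auto
    also have "\<dots> = y"
      unfolding q(2)
    proof (subst pi_eq_iff)
      show "(\<Sum>d\<in>D. restr (C d) q) \<in> polys A"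
        using CA polys_restr by (intro polys_sum) blast
      show "\<forall>e\<in>E. Poly_Mapping.lookup (\<Sum>d\<in>D. restr (C d) q) e = Poly_Mapping.lookup q e"
        using C lookup_sum_cone[of "\<lambda>d. restr (C d) q"] by (auto simp: polys_restr lookup_restr)
    qed (rule q(1))
    finally show "(\<lambda>d\<in>D. \<pi> (restr (C d) q)) \<in> (\<Pi>\<^sub>E d\<in>D. \<pi> ` polys (C d)) \<and>
        y = (\<Oplus>\<^bsub>M\<^esub>d\<in>D. (\<lambda>d\<in>D. \<pi> (restr (C d) q)) d)"
      using polys_restr by auto
    fix f assume f: "f \<in> (\<Pi>\<^sub>E d\<in>D. \<pi> ` polys (C d)) \<and> y = (\<Oplus>\<^bsub>M\<^esub>d\<in>D. f d)"
    then have "\<forall>d\<in>D. \<exists>g\<in>polys (C d). f d = \<pi> g"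
      by fast
    then obtain g where g: "\<And>d. d \<in> D \<Longrightarrow> g d \<in> polys (C d)" "\<And>d. d \<in> D \<Longrightarrow> f d = \<pi> (g d)"
      by metis
    have gA: "g d \<in> polys A" if "d \<in> D" for d
      using g(1)[OF that] CA[OF that] by blast
    have "\<pi> q = \<pi> (\<Sum>d\<in>D. g d)"
      using f q(2) finsum_pi[OF D g(2) gA] by simp
    then have "\<forall>e\<in>E. Poly_Mapping.lookup q e = Poly_Mapping.lookup (\<Sum>d\<in>D. g d) e"
      using q(1) gA by (subst (asm) pi_eq_iff) (auto intro: polys_sum)
    then have "restr (C d) q = g d" if "d \<in> D" for d
      using that C lookup_sum_cone[OF g(1) that] g(1)[OF that]
      by (intro poly_mapping_eqI) (auto simp: lookup_restr polys_iff)
    then show "f = (\<lambda>d\<in>D. \<pi> (restr (C d) q))"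
      using f g(2) by (intro PiE_ext) (auto simp: polys_restr)
  qed
qed

lemma stanley_decomposition_if_cone_partition:
  assumes "cone_partition X E D"
  shows "stanley_decomposition X M ((\<lambda>(e, Z). (\<pi> (mono e), Z)) ` D)"
proof -
  let ?h = "\<lambda>(e, Z). (\<pi> (mono e), Z)"
  have D: "finite D" "E = (\<Union>(e, Z)\<in>D. cone e Z)" "disjoint_family_on (\<lambda>(e, Z). cone e Z) D"
    and ZX: "\<And>e Z. (e, Z) \<in> D \<Longrightarrow> Z \<subseteq> X"
    using assms by (auto simp: cone_partition_def)
  have cE: "cone e Z \<subseteq> E" if "(e, Z) \<in> D" for e Z
    using that D(2) by blast
  then have eE: "e \<in> E" if "(e, Z) \<in> D" for e Z
    using that apex_in_cone by blast
  have inj: "inj_on ?h D"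
  proof (rule inj_onI)
    fix d d' assume d: "d \<in> D" "d' \<in> D" "?h d = ?h d'"
    obtain e Z e' Z' where e: "d = (e, Z)" "d' = (e', Z')"
      by (metis surj_pair)
    have "(mono e :: ('v, 'k) mpol) = mono e'"
      using d e eE by (intro pi_inj[of _ E]) (auto simp: mono_def polys_single)
    then show "d = d'"
      using d e by (simp add: mono_def) (metis keys_single one_neq_zero singleton_inject)
  qed
  \<comment> \<open>The summands are indexed by pairs with a module element, the cones by pairs with
    an exponent; the inverse of \<open>?h\<close> carries the cones over to the new index
    set.\<close>
  define C where "C = (\<lambda>(e, Z). cone e Z) \<circ> the_inv_into D ?h"
  have C: "C (?h d) = (case d of (e, Z) \<Rightarrow> cone e Z)" if "d \<in> D" for d
    using that inj unfolding C_def by (simp only: comp_apply the_inv_into_f_f)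
  have st: "stanley_space X M u Z \<and> span_space M u Z = \<pi> ` polys (C (u, Z))" if "(u, Z) \<in> ?h ` D" for u Z
  proof -
    obtain e where e: "(e, Z) \<in> D" "u = \<pi> (mono e)"
      using \<open>(u, Z) \<in> ?h ` D\<close> by auto
    then show ?thesis
      using stanley_space_mono[OF eE[OF e(1)] ZX[OF e(1)] cE[OF e(1)]] C[OF e(1)]
        span_space_single[of e 1 Z] eE[OF e(1)] ZX[OF e(1)] E_subset by (auto simp: mono_def)
  qed
  have dC: "disjoint_family_on C (?h ` D)"
    using D(3) C unfolding disjoint_family_on_def by fastforce
  have UC: "(\<Union>d\<in>?h ` D. C d) = E"
    unfolding D(2) using C by auto
  have P: "(\<Pi>\<^sub>E (u, Z)\<in>?h ` D. span_space M u Z) = (\<Pi>\<^sub>E d\<in>?h ` D. \<pi> ` polys (C d))"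
    by (rule PiE_cong) (use st in \<open>simp add: case_prod_beta\<close>)
  show ?thesis
    unfolding stanley_decomposition_def P
  proof (intro conjI ballI)
    show "finite (?h ` D)"
      using D(1) by simp
    show "case d of (u, Z) \<Rightarrow> stanley_space X M u Z" if "d \<in> ?h ` D" for d
      using that st[of "fst d" "snd d"] by (simp add: case_prod_beta)
    show "\<exists>!f. f \<in> (\<Pi>\<^sub>E d\<in>?h ` D. \<pi> ` polys (C d)) \<and> y = (\<Oplus>\<^bsub>M\<^esub>d\<in>?h ` D. f d)"
      if "y \<in> carrier M" for y
      by (rule direct_sum[OF _ dC UC that]) (simp add: D(1))
  qed
qed

text \<open>Existence of expansions makes the cones cover \<open>E\<close>, uniqueness makes them
  disjoint; both are tested on the basis elements \<open>\<pi> (mono h)\<close>.\<close>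

lemma cone_partition_if_stanley_decomposition:
  assumes "stanley_decomposition X M D" "E \<noteq> {}"
  shows "has_cone_partition X E (sdepth_decomposition D)" "D \<noteq> {}" "sdepth_decomposition D \<le> card X"
proof -
  note st = assms(1)[unfolded stanley_decomposition_def]
  have D: "finite D" "\<And>u Z. (u, Z) \<in> D \<Longrightarrow> stanley_space X M u Z"
    using st by blast+
  note ex1 = st[THEN conjunct2, THEN conjunct2, THEN bspec]
  \<comment> \<open>The zero module is free, so pairs \<open>(0, Z)\<close> count as Stanley spaces; they have to be dropped.\<close>
  let ?D = "{d\<in>D. fst d \<noteq> \<zero>\<^bsub>M\<^esub>}"
  have ZX: "Z \<subseteq> X" if "(u, Z) \<in> D" for u Z
    using D(2)[OF that] by (simp add: stanley_space_def)
  have "\<forall>d\<in>?D. \<exists>e. cone e (snd d) \<subseteq> E \<and> span_space M (fst d) (snd d) = \<pi> ` polys (cone e (snd d))"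
  proof
    fix d assume "d \<in> ?D"
    then have "stanley_space X M (fst d) (snd d)" "fst d \<noteq> \<zero>\<^bsub>M\<^esub>"
      using D(2)[of "fst d" "snd d"] by auto
    then show "\<exists>e. cone e (snd d) \<subseteq> E \<and> span_space M (fst d) (snd d) = \<pi> ` polys (cone e (snd d))"
      using stanley_space_cone by blast
  qed
  from bchoice[OF this] obtain ex where ex': "\<forall>d\<in>?D. cone (ex d) (snd d) \<subseteq> E \<and>
      span_space M (fst d) (snd d) = \<pi> ` polys (cone (ex d) (snd d))"
    by (elim exE) (rule that)
  have ex: "cone (ex d) (snd d) \<subseteq> E" "span_space M (fst d) (snd d) = \<pi> ` polys (cone (ex d) (snd d))"
    if "d \<in> ?D" for d
    using bspec[OF ex' that] by simp_all
  \<comment> \<open>With the empty set at a zero pair, whose span is the image of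
    \<open>polys {}\<close>, all members of \<open>D\<close> are treated uniformly.\<close>
  define C where "C d = (if fst d = \<zero>\<^bsub>M\<^esub> then {} else cone (ex d) (snd d))" for d
  have C: "span_space M (fst d) (snd d) = \<pi> ` polys (C d)" "C d \<subseteq> E" if "d \<in> D" for d
  proof -
    have "span_space M \<zero>\<^bsub>M\<^esub> (snd d) = \<pi> ` polys {}"
    proof -
      have "p \<odot>\<^bsub>M\<^esub> \<zero>\<^bsub>M\<^esub> = \<pi> 0" if "p \<in> polys (exps (snd d))" for p
        using that polys_mono[OF exps_mono[OF ZX[of "fst d" "snd d"]]] \<open>d \<in> D\<close> pi_smult[of p 0]
        by (auto simp: pi_zero polys_zero)
      moreover have "polys {} = {0::('v, 'k) mpol}"
        by (auto simp: polys_def)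
      ultimately show ?thesis
        by (auto simp: span_space_def carrier_poly_ring polys_zero intro!: exI[of _ 0])
    qed
    then show "span_space M (fst d) (snd d) = \<pi> ` polys (C d)" "C d \<subseteq> E"
      using that ex[of d] by (auto simp: C_def)
  qed
  have P: "(\<Pi>\<^sub>E (u, Z)\<in>D. span_space M u Z) = (\<Pi>\<^sub>E d\<in>D. \<pi> ` polys (C d))"
    by (rule PiE_cong) (use C in \<open>simp add: case_prod_beta\<close>)
  have CA: "polys (C d) \<subseteq> (polys A :: ('v, 'k) mpol set)" if "d \<in> D" for d
    using C(2)[OF that] E_subset by (intro polys_mono) blast
  have mono_carrier: "\<pi> (mono h) \<in> carrier M" if "h \<in> E" for h
    using that E_subset by (auto simp: carrier_eq mono_def polys_single subset_eq)
  \<comment> \<open>The coefficient 1 at \<open>h\<close> has to come from some summand, and the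
    support of that summand lies in its \<open>C d\<close>.\<close>
  have cover: "\<exists>d\<in>D. h \<in> C d" if h: "h \<in> E" for h
  proof -
    obtain f where f: "f \<in> (\<Pi>\<^sub>E d\<in>D. \<pi> ` polys (C d))" "\<pi> (mono h) = (\<Oplus>\<^bsub>M\<^esub>d\<in>D. f d)"
      using ex1[OF mono_carrier[OF h]] unfolding P by (elim ex1E conjE) (rule that)
    then have "\<forall>d\<in>D. \<exists>g\<in>polys (C d). f d = \<pi> g"
      by fast
    then obtain g where g: "\<And>d. d \<in> D \<Longrightarrow> g d \<in> polys (C d)" "\<And>d. d \<in> D \<Longrightarrow> f d = \<pi> (g d)"
      by metis
    have gA: "g d \<in> polys A" if "d \<in> D" for d
      using g(1)[OF that] CA[OF that] by blast
    have "\<pi> (mono h) = \<pi> (\<Sum>d\<in>D. g d)"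
      using f(2) finsum_pi[OF D(1) g(2) gA] by simp
    moreover have "(mono h :: ('v, 'k) mpol) \<in> polys A" "(\<Sum>d\<in>D. g d) \<in> polys A"
      using h E_subset gA by (auto simp: mono_def intro!: polys_sum polys_single)
    ultimately have "Poly_Mapping.lookup (\<Sum>d\<in>D. g d) h = 1"
      using h pi_eq_iff by (fastforce simp: mono_def)
    then obtain d where "d \<in> D" "Poly_Mapping.lookup (g d) h \<noteq> 0"
      by (metis (no_types, lifting) lookup_sum sum.neutral zero_neq_one)
    then have "h \<in> C d"
      using g(1)[of d] by (auto simp: polys_iff)
    then show ?thesis
      using \<open>d \<in> D\<close> by blast
  qed
  have disj: "d = d'" if d: "d \<in> D" "d' \<in> D" "h \<in> C d" "h \<in> C d'" for d d' h
  proof (rule ccontr)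
    assume "d \<noteq> d'"
    have h: "h \<in> E"
      using d(1,3) C(2) by blast
    \<comment> \<open>Put \<open>mono h\<close> entirely into component \<open>x\<close>: if
      \<open>h\<close> lay in both \<open>C d\<close> and \<open>C d'\<close>, the choices
      \<open>x = d\<close> and \<open>x = d'\<close> would be two decompositions of one
      element.\<close>
    define g where "g x = (\<lambda>z\<in>D. if z = x then mono h else 0 :: ('v, 'k) mpol)" for x
    let ?F = "\<lambda>x. (\<lambda>z\<in>D. \<pi> (g x z))"
    have F: "?F x \<in> (\<Pi>\<^sub>E d\<in>D. \<pi> ` polys (C d)) \<and> \<pi> (mono h) = (\<Oplus>\<^bsub>M\<^esub>d\<in>D. ?F x d)"
      if "x \<in> D" "h \<in> C x" for x
    proof -
      have g: "g x z \<in> polys (C z)" if "z \<in> D" for z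
        using that \<open>h \<in> C x\<close> by (simp add: g_def mono_def polys_single polys_zero)
      have "(\<Oplus>\<^bsub>M\<^esub>d\<in>D. ?F x d) = \<pi> (\<Sum>z\<in>D. g x z)"
        using subsetD[OF CA g] by (intro finsum_pi[OF D(1)]) auto
      also have "(\<Sum>z\<in>D. g x z) = mono h"
        using D(1) that(1) by (simp add: g_def)
      finally show ?thesis
        using g by auto
    qed
    have "?F d = ?F d'"
      by (rule Ex1_unique[OF ex1[OF mono_carrier[OF h], unfolded P]]) (rule F[OF d(1,3)] F[OF d(2,4)])+
    then have "?F d d = ?F d' d"
      by (rule fun_cong)
    then have "\<pi> (mono h) = \<pi> 0"
      using d(1) \<open>d \<noteq> d'\<close> by (simp add: g_def)
    then have "(mono h :: ('v, 'k) mpol) = 0"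
      using h by (intro pi_inj[of _ E]) (auto simp: mono_def polys_single polys_zero)
    then show False
      by (metis keys_single keys_zero mono_def insert_not_empty one_neq_zero)
  qed
  have "cone_partition X E ((\<lambda>d. (ex d, snd d)) ` ?D)"
    unfolding cone_partition_def
  proof (intro conjI)
    have "(\<Union>(e, Z)\<in>(\<lambda>d. (ex d, snd d)) ` ?D. cone e Z) = (\<Union>d\<in>D. C d)"
      by (auto simp: C_def split: if_splits)
    moreover have "(\<Union>d\<in>D. C d) \<subseteq> E"
      using C(2) by (rule UN_least)
    moreover have "E \<subseteq> (\<Union>d\<in>D. C d)"
      by (rule subsetI) (simp add: cover)
    ultimately show "E = (\<Union>(e, Z)\<in>(\<lambda>d. (ex d, snd d)) ` ?D. cone e Z)"
      by simp
    show "disjoint_family_on (\<lambda>(e, Z). cone e Z) ((\<lambda>d. (ex d, snd d)) ` ?D)"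
      unfolding disjoint_family_on_def
    proof (intro ballI impI)
      fix p q assume pq: "p \<in> (\<lambda>d. (ex d, snd d)) ` ?D" "q \<in> (\<lambda>d. (ex d, snd d)) ` ?D" "p \<noteq> q"
      obtain d where d: "d \<in> ?D" "p = (ex d, snd d)"
        using pq(1) by (rule imageE)
      obtain d' where d': "d' \<in> ?D" "q = (ex d', snd d')"
        using pq(2) by (rule imageE)
      have "x \<notin> C d \<inter> C d'" for x
        using disj[of d d' x] d d' pq(3) by auto
      then show "(case p of (e, Z) \<Rightarrow> cone e Z) \<inter> (case q of (e, Z) \<Rightarrow> cone e Z) = {}"
        using d d' by (auto simp: C_def)
    qed
    show "finite ((\<lambda>d. (ex d, snd d)) ` ?D)"
      using D(1) by simp
    show "\<forall>(e, Z)\<in>(\<lambda>d. (ex d, snd d)) ` ?D. Z \<subseteq> X"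
      using ZX by auto
  qed
  moreover have le: "sdepth_decomposition D \<le> card Z" if "(u, Z) \<in> D" for u Z
    unfolding sdepth_decomposition_def using D(1) that by (intro Min_le) force+
  \<comment> \<open>Dropping the zero pairs can only raise the minimum, so the bound taken over all
    of \<open>D\<close> persists.\<close>
  moreover have "\<forall>(e, Z)\<in>(\<lambda>d. (ex d, snd d)) ` ?D. sdepth_decomposition D \<le> card Z"
    using le by auto
  ultimately show "has_cone_partition X E (sdepth_decomposition D)"
    unfolding has_cone_partition_def by blast
  show "D \<noteq> {}"
    using cover assms(2) by blast
  then obtain u Z where "(u, Z) \<in> D"
    by fast
  then show "sdepth_decomposition D \<le> card X"
    using le ZX finite_vars by (meson card_mono le_trans)
qed

section \<open>Stanley depth as an attained maximum\<close>

lemma finite_sdepths: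
  assumes "E \<noteq> {}"
  shows "finite {sdepth_decomposition D |D. stanley_decomposition X M D}"
  using cone_partition_if_stanley_decomposition(3)[OF _ assms]
  by (intro finite_subset[OF _ finite_atMost[of "card X"]]) blast

lemma has_cone_partition_sdepth_decomposition:
  assumes "has_cone_partition X E m" "E \<noteq> {}"
  obtains D where "stanley_decomposition X M D" "m \<le> sdepth_decomposition D"
proof -
  obtain D where D: "cone_partition X E D" "\<forall>(e, Z)\<in>D. m \<le> card Z"
    using assms(1) by (auto simp: has_cone_partition_def)
  let ?D = "(\<lambda>(e, Z). (\<pi> (mono e), Z)) ` D"
  have "finite ?D" "?D \<noteq> {}"
    using D(1) assms(2) by (auto simp: cone_partition_def)
  then have "m \<le> sdepth_decomposition ?D"
    unfolding sdepth_decomposition_def using D(2) by (subst Min_ge_iff) auto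
  then show ?thesis
    using that stanley_decomposition_if_cone_partition[OF D(1)] by blast
qed

lemma sdepth_ge:
  assumes "has_cone_partition X E m" "E \<noteq> {}"
  shows "m \<le> sdepth X M"
proof -
  obtain D where "stanley_decomposition X M D" "m \<le> sdepth_decomposition D"
    using has_cone_partition_sdepth_decomposition[OF assms] .
  then show ?thesis
    unfolding sdepth_def using finite_sdepths[OF assms(2)] by (auto intro!: Max_ge_iff[THEN iffD2])
qed

text \<open>The given partition, of whatever quality, shows that the finite set of values is
  nonempty; hence the maximum is attained by a decomposition, which yields the partition.\<close>

lemma has_cone_partition_sdepth:
  assumes "has_cone_partition X E m" "E \<noteq> {}"
  shows "has_cone_partition X E (sdepth X M)"
proof -
  obtain D where "stanley_decomposition X M D"
    using has_cone_partition_sdepth_decomposition[OF assms] .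
  then have "sdepth X M \<in> {sdepth_decomposition D |D. stanley_decomposition X M D}"
    unfolding sdepth_def using finite_sdepths[OF assms(2)] by (intro Max_in) auto
  then obtain D where "stanley_decomposition X M D" "sdepth X M = sdepth_decomposition D"
    by blast
  then show ?thesis
    using cone_partition_if_stanley_decomposition(1)[OF _ assms(2)] by simp
qed

end

section \<open>Monomial ideals\<close>

lemma poly_ring_cring: "cring (poly_ring X :: ('v, 'k::field) mpol ring)"
proof (rule cringI)
  show "abelian_group (poly_ring X :: ('v, 'k) mpol ring)"
  proof (rule abelian_groupI)
    fix p :: "('v, 'k) mpol" assume "p \<in> carrier (poly_ring X)"
    then show "\<exists>q\<in>carrier (poly_ring X). q \<oplus>\<^bsub>poly_ring X\<^esub> p = \<zero>\<^bsub>poly_ring X\<^esub>"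
      by (intro bexI[of _ "- p"]) (auto simp: carrier_poly_ring polys_uminus)
  qed (auto simp: carrier_poly_ring polys_zero polys_add ac_simps)
  show "comm_monoid (poly_ring X :: ('v, 'k) mpol ring)"
  proof (rule comm_monoidI)
    show "\<one>\<^bsub>poly_ring X\<^esub> \<in> carrier (poly_ring X :: ('v, 'k) mpol ring)"
      by (simp add: carrier_poly_ring polys_def exps_def)
  qed (auto simp: carrier_poly_ring ac_simps intro!: polys_mult exps_add)
qed (simp add: algebra_simps)

text \<open>The exponent sets of monomial ideals: divisibility of monomials becomes an upward
  closure.\<close>

definition monomial_upset :: "'v set \<Rightarrow> ('v \<Rightarrow>\<^sub>0 nat) set \<Rightarrow> bool" where
  "monomial_upset X N \<longleftrightarrow> N \<subseteq> exps X \<and> (\<forall>e\<in>N. \<forall>v\<in>exps X. v + e \<in> N)"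

lemma ideal_polys:
  assumes "monomial_upset X N"
  shows "ideal (polys N :: ('v, 'k::field) mpol set) (poly_ring X)"
proof (rule idealI)
  interpret R: cring "poly_ring X :: ('v, 'k) mpol ring"
    by (rule poly_ring_cring)
  show "ring (poly_ring X :: ('v, 'k) mpol ring)"
    by (rule R.ring_axioms)
  have up: "N \<subseteq> exps X" "\<And>e v. e \<in> N \<Longrightarrow> v \<in> exps X \<Longrightarrow> v + e \<in> N"
    using assms by (auto simp: monomial_upset_def)
  show "subgroup (polys N :: ('v, 'k) mpol set) (add_monoid (poly_ring X))"
  proof (rule R.add.subgroupI)
    show "polys N \<subseteq> carrier (poly_ring X :: ('v, 'k) mpol ring)"
      unfolding carrier_poly_ring by (rule polys_mono[OF up(1)])
    show "polys N \<noteq> ({} :: ('v, 'k) mpol set)"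
      using polys_zero by blast
    fix p :: "('v, 'k) mpol" assume p: "p \<in> polys N"
    then have "p \<in> carrier (poly_ring X)" "- p \<in> carrier (poly_ring X)"
      using polys_mono[OF up(1)] polys_uminus by (auto simp: carrier_poly_ring)
    then have "\<ominus>\<^bsub>poly_ring X\<^esub> p = - p"
      by (intro R.minus_equality) auto
    then show "\<ominus>\<^bsub>poly_ring X\<^esub> p \<in> polys N"
      using p polys_uminus by simp
  qed (simp add: polys_add)
  fix p x :: "('v, 'k) mpol" assume p: "p \<in> polys N" "x \<in> carrier (poly_ring X)"
  then have "x * p \<in> polys N"
    using up(2) by (intro polys_mult[of x "exps X" p N N]) (auto simp: carrier_poly_ring)
  then show "x \<otimes>\<^bsub>poly_ring X\<^esub> p \<in> polys N" "p \<otimes>\<^bsub>poly_ring X\<^esub> x \<in> polys N"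
    by (simp_all add: mult.commute)
qed

lemma monomial_subquotient_ideal_module:
  assumes "finite X" "monomial_upset X N"
  shows "monomial_subquotient X N N (ideal_module (polys N :: ('v, 'k::field) mpol set)) id"
proof (unfold_locales, goal_cases)
  case (7 f g)
  show ?case
  proof
    assume "\<forall>e\<in>N. Poly_Mapping.lookup f e = Poly_Mapping.lookup g e"
    then have "Poly_Mapping.lookup f e = Poly_Mapping.lookup g e" for e
      using 7 by (cases "e \<in> N") (auto simp: polys_iff)
    then show "id f = id g"
      by (simp add: poly_mapping_eqI)
  qed simp
qed (use assms in \<open>auto simp: ideal_module_def monomial_upset_def\<close>)

lemma coset_polys_eq_iff:
  "polys N +>\<^bsub>poly_ring X\<^esub> f = polys N +>\<^bsub>poly_ring X\<^esub> g \<longleftrightarrow> f - g \<in> polys N"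
  for f g :: "('v, 'k::field) mpol"
proof -
  have c: "polys N +>\<^bsub>poly_ring X\<^esub> h = {p. p - h \<in> polys N}" for h :: "('v, 'k) mpol"
    by (auto simp: a_r_coset_def r_coset_def intro!: bexI[of _ "_ - h"])
  show ?thesis
  proof
    assume "polys N +>\<^bsub>poly_ring X\<^esub> f = polys N +>\<^bsub>poly_ring X\<^esub> g"
    moreover have "f \<in> polys N +>\<^bsub>poly_ring X\<^esub> f"
      by (simp add: c polys_zero)
    ultimately show "f - g \<in> polys N"
      by (simp add: c)
  next
    assume "f - g \<in> polys N"
    then show "polys N +>\<^bsub>poly_ring X\<^esub> f = polys N +>\<^bsub>poly_ring X\<^esub> g"
      by (auto simp: c polys_iff lookup_minus)
  qed
qed

text \<open>Here \<open>E\<close> consists of the standard exponents: two polynomials have the same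
  coset iff they agree there.\<close>

lemma monomial_subquotient_quotient_module:
  assumes "finite X" "monomial_upset X N"
  shows "monomial_subquotient X (exps X) (exps X - N)
    (quotient_module X (polys N :: ('v, 'k::field) mpol set)) (\<lambda>f. polys N +>\<^bsub>poly_ring X\<^esub> f)"
proof -
  interpret ideal "polys N :: ('v, 'k) mpol set" "poly_ring X"
    using assms(2) by (rule ideal_polys)
  have up: "N \<subseteq> exps X" "\<And>e v. e \<in> N \<Longrightarrow> v \<in> exps X \<Longrightarrow> v + e \<in> N"
    using assms(2) by (auto simp: monomial_upset_def)
  have eq: "polys N +>\<^bsub>poly_ring X\<^esub> f = polys N +>\<^bsub>poly_ring X\<^esub> g \<longleftrightarrow>
      (\<forall>e\<in>exps X - N. Poly_Mapping.lookup f e = Poly_Mapping.lookup g e)"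
    if "f \<in> polys (exps X)" "g \<in> polys (exps X)" for f g :: "('v, 'k) mpol"
    using that unfolding coset_polys_eq_iff polys_iff lookup_minus by (metis Diff_iff eq_iff_diff_eq_0)
  show ?thesis
  proof (unfold_locales, goal_cases)
    case (6)
    show ?case
      by (auto simp: quotient_module_def Let_def FactRing_def A_RCOSETS_def' carrier_poly_ring)
  next
    case (7 f g)
    then show ?case by (rule eq)
  next
    case (8 f g)
    then have "f \<in> carrier (poly_ring X)" "g \<in> carrier (poly_ring X)"
      by (simp_all add: carrier_poly_ring)
    then show ?case
      by (simp add: quotient_module_def Let_def FactRing_def a_rcos_sum)
  next
    case 9
    show ?case
      by (auto simp: quotient_module_def Let_def FactRing_def a_r_coset_def r_coset_def)
  next
    case (10 p f)
    then have "p \<in> carrier (poly_ring X)" "f \<in> carrier (poly_ring X)"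
      by (simp_all add: carrier_poly_ring)
    then show ?case
      by (simp add: quotient_module_def Let_def rcoset_mult_add)
  next
    case (11 g)
    show ?case
      by (auto simp: quotient_module_def Let_def carrier_poly_ring)
  qed (use assms up in \<open>auto intro: exps_add\<close>)
qed

section \<open>Exponent sets of irreducible monomial ideals\<close>

lemma mono_eq_iff: "(mono e :: ('v, 'k::field) mpol) = mono f \<longleftrightarrow> e = f"
  unfolding mono_def by (metis keys_single one_neq_zero singleton_inject)

lemma mono_in_polys_iff: "(mono e :: ('v, 'k::field) mpol) \<in> polys N \<longleftrightarrow> e \<in> N"
  by (simp add: mono_def polys_def)

lemma var_power: "(var i :: ('v, 'k::field) mpol) ^ m = mono (Poly_Mapping.single i m)"
proof (induction m)
  case 0
  then show ?case
    by (simp add: mono_def)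
next
  case (Suc m)
  then show ?case
    by (simp add: var_def mono_def mult_single single_add[symmetric])
qed

text \<open>The monomials divisible by x_i^(b i) for some i in \<open>T\<close>. The ambient
  variables are left open, so that one set serves the full ring and both of its smaller rings after
  intersection with the relevant \<open>exps\<close>.\<close>

definition pure_power_upset :: "'v set \<Rightarrow> ('v \<Rightarrow> nat) \<Rightarrow> ('v \<Rightarrow>\<^sub>0 nat) set" where
  "pure_power_upset T b = {e. \<exists>i\<in>T. b i \<le> Poly_Mapping.lookup e i}"

lemma pure_power_upset_add: "e \<in> pure_power_upset T b \<Longrightarrow> v + e \<in> pure_power_upset T b"
  by (auto simp: pure_power_upset_def lookup_add) (meson trans_le_add2)

text \<open>A relation \<open>P\<close> rather than an exponent function, because a generating set
  of pure powers may contain several powers of one variable; for the distinguished component it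
  specializes to \<open>m = a i\<close>.\<close>

lemma Idl_pure_powers:
  assumes "\<And>i. i \<in> T \<Longrightarrow> i \<in> X"
  shows "Idl\<^bsub>poly_ring X\<^esub> {(var i :: ('v, 'k::field) mpol) ^ m |i m. i \<in> T \<and> P i m} =
    polys {e \<in> exps X. \<exists>i\<in>T. \<exists>m. P i m \<and> m \<le> Poly_Mapping.lookup e i}"
    (is "Idl\<^bsub>_\<^esub> ?A = polys ?N")
proof
  interpret R: cring "poly_ring X :: ('v, 'k) mpol ring"
    by (rule poly_ring_cring)
  have "monomial_upset X ?N"
    by (auto simp: monomial_upset_def lookup_add intro!: exps_add) (meson trans_le_add2)
  moreover have AN: "?A \<subseteq> polys ?N"
    using assms by (fastforce simp: var_power mono_in_polys_iff exps_def)
  ultimately show "Idl\<^bsub>poly_ring X\<^esub> ?A \<subseteq> polys ?N"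
    by (intro R.genideal_minimal ideal_polys)
  have A_carrier: "?A \<subseteq> carrier (poly_ring X)"
    using AN polys_mono[of ?N "exps X"] unfolding carrier_poly_ring by blast
  interpret I: ideal "Idl\<^bsub>poly_ring X\<^esub> ?A" "poly_ring X"
    by (rule R.genideal_ideal[OF A_carrier])
  have single: "Poly_Mapping.single e c \<in> Idl\<^bsub>poly_ring X\<^esub> ?A" if e: "e \<in> ?N" for e c
  proof -
    obtain i m where im: "e \<in> exps X" "i \<in> T" "P i m" "m \<le> Poly_Mapping.lookup e i"
      using e by blast
    \<comment> \<open>The cofactor of the term at \<open>e\<close> with respect to the generator
      dividing it.\<close>
    let ?d = "e - Poly_Mapping.single i m"
    have "(var i :: ('v, 'k) mpol) ^ m \<in> Idl\<^bsub>poly_ring X\<^esub> ?A"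
      using R.genideal_self[OF A_carrier] im by blast
    moreover have "Poly_Mapping.single ?d c \<in> carrier (poly_ring X)"
      unfolding carrier_poly_ring using im(1) by (intro polys_single) (simp add: exps_iff lookup_minus)
    ultimately have "Poly_Mapping.single ?d c * var i ^ m \<in> Idl\<^bsub>poly_ring X\<^esub> ?A"
      using I.I_l_closed by fastforce
    moreover have "?d + Poly_Mapping.single i m = e"
      using im(4) by (intro poly_mapping_eqI) (auto simp: lookup_add lookup_minus lookup_single when_def split: if_splits)
    ultimately show ?thesis
      by (simp add: var_power mono_def mult_single)
  qed
  show "polys ?N \<subseteq> Idl\<^bsub>poly_ring X\<^esub> ?A"
  proof
    fix p :: "('v, 'k) mpol" assume "p \<in> polys ?N"
    then have "Poly_Mapping.keys p \<subseteq> ?N"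
      by (simp add: polys_def)
    have "(\<Sum>e\<in>S. Poly_Mapping.single e (Poly_Mapping.lookup p e)) \<in> Idl\<^bsub>poly_ring X\<^esub> ?A"
      if "finite S" "S \<subseteq> ?N" for S
      using that
    proof (induction S)
      case empty
      then show ?case
        using I.zero_closed by simp
    next
      case (insert e S)
      then have "Poly_Mapping.single e (Poly_Mapping.lookup p e) \<in> Idl\<^bsub>poly_ring X\<^esub> ?A"
        "(\<Sum>e\<in>S. Poly_Mapping.single e (Poly_Mapping.lookup p e)) \<in> Idl\<^bsub>poly_ring X\<^esub> ?A"
        using single by auto
      then show ?case
        using I.a_closed insert.hyps by fastforce
    qed
    from this[OF finite_keys \<open>Poly_Mapping.keys p \<subseteq> ?N\<close>] show "p \<in> Idl\<^bsub>poly_ring X\<^esub> ?A"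
      by (simp only: poly_mapping_sum_single[symmetric])
  qed
qed

lemma irreducible_monomial_ideal_pure_power:
  assumes "irreducible_monomial_ideal X (I :: ('v, 'k::field) mpol set)"
  obtains T b where "T \<subseteq> X" "\<And>i. i \<in> T \<Longrightarrow> 0 < b i" "I = polys (exps X \<inter> pure_power_upset T b)"
proof -
  obtain A where A: "A \<subseteq> {var i ^ m |i m. i \<in> X \<and> 0 < m}" "I = Idl\<^bsub>poly_ring X\<^esub> A"
    using assms by (auto simp: irreducible_monomial_ideal_def)
  define P where "P i m \<longleftrightarrow> 0 < m \<and> (var i :: ('v, 'k) mpol) ^ m \<in> A" for i m
  define T where "T = {i \<in> X. \<exists>m. P i m}"
  \<comment> \<open>Among the generating powers of one variable only the smallest matters.\<close>
  define b where "b i = (LEAST m. P i m)" for i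
  have b: "P i (b i)" if "i \<in> T" for i
    using that by (auto simp: T_def b_def intro: LeastI)
  have "A = {var i ^ m |i m. i \<in> T \<and> P i m}"
    using A(1) unfolding T_def P_def by blast
  then have "I = polys {e \<in> exps X. \<exists>i\<in>T. \<exists>m. P i m \<and> m \<le> Poly_Mapping.lookup e i}"
    using Idl_pure_powers[of T X P] A(2) by (auto simp: T_def)
  also have "{e \<in> exps X. \<exists>i\<in>T. \<exists>m. P i m \<and> m \<le> Poly_Mapping.lookup e i} =
      exps X \<inter> pure_power_upset T b"
    using b by (auto simp: pure_power_upset_def b_def intro: order_trans[OF Least_le])
  finally show ?thesis
    using that[of T b] b by (auto simp: T_def P_def)
qed

section \<open>Sums, radicals and colons in terms of exponents\<close>

lemma mono_in_ideal_sum_polys_iff: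
  assumes "finite S"
  shows "(mono e :: ('v, 'k::field) mpol) \<in> ideal_sum S (\<lambda>j. polys (N j)) \<longleftrightarrow> (\<exists>j\<in>S. e \<in> N j)"
proof
  assume "(mono e :: ('v, 'k) mpol) \<in> ideal_sum S (\<lambda>j. polys (N j))"
  then obtain f where f: "(mono e :: ('v, 'k) mpol) = (\<Sum>j\<in>S. f j)" "\<forall>j\<in>S. f j \<in> polys (N j)"
    by (auto simp: ideal_sum_def)
  have "(\<Sum>j\<in>S. Poly_Mapping.lookup (f j) e) = 1"
    using arg_cong[OF f(1), of "\<lambda>p. Poly_Mapping.lookup p e"] by (simp add: mono_def lookup_sum)
  then obtain j where "j \<in> S" "Poly_Mapping.lookup (f j) e \<noteq> 0"
    by (metis (no_types, lifting) sum.neutral zero_neq_one)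
  then show "\<exists>j\<in>S. e \<in> N j"
    using f(2) by (auto simp: polys_iff)
next
  assume "\<exists>j\<in>S. e \<in> N j"
  then obtain j where j: "j \<in> S" "e \<in> N j"
    by blast
  have "(mono e :: ('v, 'k) mpol) = (\<Sum>i\<in>S. if i = j then mono e else 0)"
    using assms j(1) by simp
  moreover have "\<forall>i\<in>S. (if i = j then mono e else 0 :: ('v, 'k) mpol) \<in> polys (N i)"
    using j(2) by (simp add: mono_in_polys_iff polys_zero)
  ultimately show "(mono e :: ('v, 'k) mpol) \<in> ideal_sum S (\<lambda>j. polys (N j))"
    unfolding ideal_sum_def by (intro CollectI exI conjI)
qed

text \<open>Setting the variables in \<open>T\<close> to zero is a ring homomorphism into an integral domain.\<close>

lemma polys_prime:
  fixes p q :: "('v::linorder, 'k::field) mpol"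
  assumes "p * q \<in> polys (- exps (- T))"
  shows "p \<in> polys (- exps (- T)) \<or> q \<in> polys (- exps (- T))"
proof -
  let ?U = "exps (- T) :: ('v \<Rightarrow>\<^sub>0 nat) set"
  have split: "f = restr ?U f + restr (- ?U) f" for f :: "('v, 'k) mpol"
    by (rule poly_mapping_eqI) (simp add: lookup_add lookup_restr)
  have closed: "a \<in> - ?U \<Longrightarrow> a + c \<in> - ?U" "a \<in> - ?U \<Longrightarrow> c + a \<in> - ?U" for a c
    by (auto simp: exps_iff lookup_add)
  have "p * q = (restr ?U p + restr (- ?U) p) * q"
    by (subst split[symmetric]) simp
  also have "\<dots> = restr ?U p * (restr ?U q + restr (- ?U) q) + restr (- ?U) p * q"
    by (subst split[symmetric]) (simp add: distrib_right)
  finally have "p * q = restr ?U p * restr ?U q + (restr ?U p * restr (- ?U) q + restr (- ?U) p * q)"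
    by (simp add: distrib_left add.assoc)
  moreover have "restr ?U p * restr (- ?U) q \<in> polys (- ?U)" "restr (- ?U) p * q \<in> polys (- ?U)"
    using closed by (auto intro!: polys_mult[OF polys_restr polys_restr]
        polys_mult[where q = q and B = UNIV, OF polys_restr]) (auto simp: polys_def)
  ultimately have "restr ?U p * restr ?U q \<in> polys (- ?U)"
    using assms by (auto simp: polys_iff lookup_add)
  moreover have "restr ?U p * restr ?U q \<in> polys ?U"
    by (intro polys_mult[OF polys_restr polys_restr] exps_add)
  ultimately have "restr ?U p * restr ?U q = 0"
    by (intro poly_mapping_eqI) (auto simp: polys_iff)
  \<comment> \<open>There are no zero divisors; the linear order on the variables is what supplies
    this fact for polynomials.\<close>
  then have "restr ?U p = 0 \<or> restr ?U q = 0"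
    by simp
  then show ?thesis
    using split[of p] split[of q] polys_restr[of "- ?U"] by (metis add_0)
qed

text \<open>The right-hand side is the span of the monomials involving a variable of
  \<open>T\<close>, a monomial prime that excludes 1. This inclusion is all that is required to
  decide which variables lie in the radical.\<close>

lemma radical_pure_power_subset:
  fixes T :: "'v::linorder set"
  assumes "\<And>i. i \<in> T \<Longrightarrow> 0 < b i"
  shows "radical X (polys (exps X \<inter> pure_power_upset T b) :: ('v, 'k::field) mpol set)
    \<subseteq> polys (- exps (- T))"
proof
  fix f :: "('v, 'k) mpol" assume "f \<in> radical X (polys (exps X \<inter> pure_power_upset T b))"
  then obtain m where m: "f ^ m \<in> polys (exps X \<inter> pure_power_upset T b)"
    by (auto simp: radical_def)
  have "exps X \<inter> pure_power_upset T b \<subseteq> - exps (- T)"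
    using assms by (force simp: pure_power_upset_def exps_iff)
  then have "f ^ m \<in> polys (- exps (- T))"
    using m polys_mono by blast
  then show "f \<in> polys (- exps (- T))"
  proof (induction m)
    case 0
    then show ?case
      using zero_in_exps by (auto simp: polys_def)
  next
    case (Suc m)
    then show ?case
      using polys_prime[of f "f ^ m" T] by auto
  qed
qed

text \<open>Enlarging each radical to the monomial prime above it makes the sum monomial, so a
  variable lies in it only through one summand. Conversely \<open>b j i\<close> is a power that puts
  the variable into the radical.\<close>

lemma var_in_radical_sum_iff:
  fixes T :: "'j \<Rightarrow> 'v::linorder set"
  assumes "finite S" "\<And>j i. j \<in> S \<Longrightarrow> i \<in> T j \<Longrightarrow> 0 < b j i" "\<And>j. j \<in> S \<Longrightarrow> T j \<subseteq> X"
  shows "(var i :: ('v, 'k::field) mpol) \<in>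
      ideal_sum S (\<lambda>j. radical X (polys (exps X \<inter> pure_power_upset (T j) (b j)))) \<longleftrightarrow> i \<in> (\<Union>j\<in>S. T j)"
proof
  assume "(var i :: ('v, 'k) mpol) \<in>
      ideal_sum S (\<lambda>j. radical X (polys (exps X \<inter> pure_power_upset (T j) (b j))))"
  then have "(var i :: ('v, 'k) mpol) \<in> ideal_sum S (\<lambda>j. polys (- exps (- T j)))"
    using radical_pure_power_subset[of "T _" "b _"] assms(2) unfolding ideal_sum_def by blast
  then show "i \<in> (\<Union>j\<in>S. T j)"
    by (auto simp: var_def mono_in_ideal_sum_polys_iff[OF assms(1)] exps_def)
next
  assume "i \<in> (\<Union>j\<in>S. T j)"
  then obtain j where j: "j \<in> S" "i \<in> T j"
    by blast
  have "i \<in> X"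
    using j assms(3) by blast
  then have "(var i :: ('v, 'k) mpol) \<in> carrier (poly_ring X)"
    by (simp add: carrier_poly_ring var_def mono_in_polys_iff exps_def)
  moreover have "(var i :: ('v, 'k) mpol) ^ b j i \<in> polys (exps X \<inter> pure_power_upset (T j) (b j))"
    using j \<open>i \<in> X\<close>
    by (auto simp: var_power mono_in_polys_iff exps_def pure_power_upset_def intro!: bexI[of _ i])
  ultimately have rad: "(var i :: ('v, 'k) mpol) \<in> radical X (polys (exps X \<inter> pure_power_upset (T j) (b j)))"
    by (auto simp: radical_def)
  have zero: "(0 :: ('v, 'k) mpol) \<in> radical X (polys N)" for N
    by (auto simp: radical_def carrier_poly_ring polys_zero intro!: exI[of _ 1])
  have "(var i :: ('v, 'k) mpol) = (\<Sum>l\<in>S. if l = j then var i else 0)"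
    using assms(1) j(1) by simp
  moreover have "\<forall>l\<in>S. (if l = j then var i else 0 :: ('v, 'k) mpol) \<in>
      radical X (polys (exps X \<inter> pure_power_upset (T l) (b l)))"
    using rad zero by simp
  ultimately show "(var i :: ('v, 'k) mpol) \<in>
      ideal_sum S (\<lambda>j. radical X (polys (exps X \<inter> pure_power_upset (T j) (b j))))"
    unfolding ideal_sum_def by (intro CollectI exI conjI)
qed

lemma colon_polys: "colon X (polys N) (mono w) = polys {e \<in> exps X. e + w \<in> N}"
proof (intro subset_antisym subsetI)
  fix f :: "('a, 'b) mpol" assume f: "f \<in> colon X (polys N) (mono w)"
  show "f \<in> polys {e \<in> exps X. e + w \<in> N}"
  proof -
    have "Poly_Mapping.lookup (f * mono w) (e + w) = Poly_Mapping.lookup f e" for e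
      using lookup_mult_single[of f w 1 e] by (simp add: mono_def)
    then show ?thesis
      using f unfolding colon_def carrier_poly_ring polys_iff by (metis (mono_tags, lifting) mem_Collect_eq)
  qed
next
  fix f :: "('a, 'b) mpol" assume "f \<in> polys {e \<in> exps X. e + w \<in> N}"
  moreover from this have "f * mono w \<in> polys N"
    by (rule polys_mult[where B = "{w}"]) (auto simp: mono_in_polys_iff)
  ultimately show "f \<in> colon X (polys N) (mono w)"
    using polys_mono[of "{e \<in> exps X. e + w \<in> N}" "exps X"] by (auto simp: colon_def carrier_poly_ring)
qed

lemma INT_polys: "(\<Inter>j\<in>J. polys (N j)) = polys (\<Inter>j\<in>J. N j)"
  by (auto simp: polys_def)

lemma polys_Int: "polys M \<inter> polys N = polys (M \<inter> N)"
  by (auto simp: polys_def)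

section \<open>Splitting the standard monomials\<close>

text \<open>A pure power tests a single coordinate, and at each coordinate at most one of
  \<open>a\<close> and \<open>c\<close> is nonzero.\<close>

lemma pure_power_upset_add_iff:
  assumes "X \<inter> Y = {}" "a \<in> exps X" "c \<in> exps Y" "\<And>i. i \<in> T \<Longrightarrow> 0 < b i"
  shows "a + c \<in> pure_power_upset T b \<longleftrightarrow> a \<in> pure_power_upset T b \<or> c \<in> pure_power_upset T b"
proof -
  have "b i \<le> Poly_Mapping.lookup a i + Poly_Mapping.lookup c i \<longleftrightarrow>
      b i \<le> Poly_Mapping.lookup a i \<or> b i \<le> Poly_Mapping.lookup c i" for i
  proof (cases "i \<in> X")
    case True
    then have "Poly_Mapping.lookup c i = 0"
      using assms(1,3) by (auto simp: exps_iff)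
    then show ?thesis by auto
  next
    case False
    then have "Poly_Mapping.lookup a i = 0"
      using assms(2) by (auto simp: exps_iff)
    then show ?thesis by auto
  qed
  then show ?thesis
    by (auto simp: pure_power_upset_def lookup_add)
qed

lemma not_in_pure_power_upset:
  assumes "c \<in> exps Y" "Y \<inter> T = {}" "\<And>i. i \<in> T \<Longrightarrow> 0 < b i"
  shows "c \<notin> pure_power_upset T b"
proof
  assume "c \<in> pure_power_upset T b"
  then obtain i where "i \<in> T" "b i \<le> Poly_Mapping.lookup c i"
    by (auto simp: pure_power_upset_def)
  moreover have "Poly_Mapping.lookup c i = 0"
    using \<open>i \<in> T\<close> assms(1,2) by (auto simp: exps_iff)
  ultimately show False
    using assms(3)[of i] by simp
qed

text \<open>Above \<open>N\<close> the truncated coordinate alone already reaches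
  \<open>b i\<close>. The shift \<open>w\<close> is added after truncation, as the colon by a
  monomial requires.\<close>

lemma map_min_in_pure_power_upset_iff:
  assumes "\<And>i. i \<in> T \<Longrightarrow> b i \<le> N"
  shows "Poly_Mapping.map (min N) e + w \<in> pure_power_upset T b \<longleftrightarrow> e + w \<in> pure_power_upset T b"
proof -
  have "b i \<le> min N (Poly_Mapping.lookup e i) + Poly_Mapping.lookup w i \<longleftrightarrow>
      b i \<le> Poly_Mapping.lookup e i + Poly_Mapping.lookup w i" if "i \<in> T" for i
    using assms[OF that] by linarith
  then show ?thesis
    by (auto simp: pure_power_upset_def lookup_add lookup_map_min)
qed

text \<open>Source of all finiteness of index sets: every variable of \<open>w\<close> belongs to
  some \<open>T j\<close>, and staying outside that ideal keeps its exponent below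
  \<open>b j i\<close>.\<close>

lemma bounded_if_not_in_pure_power_upset:
  assumes "w \<in> exps (\<Union>j\<in>S. T j)" "\<And>j. j \<in> S \<Longrightarrow> w \<notin> pure_power_upset (T j) (b j)"
    and "\<And>j i. j \<in> S \<Longrightarrow> i \<in> T j \<Longrightarrow> b j i \<le> N"
  shows "Poly_Mapping.lookup w i \<le> N"
proof (cases "i \<in> (\<Union>j\<in>S. T j)")
  case True
  then obtain j where j: "j \<in> S" "i \<in> T j"
    by blast
  then have "Poly_Mapping.lookup w i < b j i"
    using assms(2)[OF j(1)] by (force simp: pure_power_upset_def)
  then show ?thesis
    using assms(3)[OF j] by simp
next
  case False
  then show ?thesis
    using assms(1) by (simp add: exps_iff)
qed

lemma uniform_bound:
  fixes b :: "'j \<Rightarrow> 'v \<Rightarrow> nat"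
  assumes "finite S" "\<And>j. j \<in> S \<Longrightarrow> finite (T j)"
  obtains N where "\<And>j i. j \<in> S \<Longrightarrow> i \<in> T j \<Longrightarrow> b j i \<le> N"
proof -
  have "finite (\<Union>j\<in>S. b j ` T j)"
    using assms by simp
  then obtain N where "\<forall>x\<in>(\<Union>j\<in>S. b j ` T j). x \<le> N"
    using finite_nat_set_iff_bounded_le by blast
  then show ?thesis
    using that by blast
qed

text \<open>The combinatorial core, free of algebra: \<open>X\<close> holds the variables of the
  distinguished component \<open>k\<close>, \<open>Y\<close> the others, and \<open>parts\<close>
  supplies for each nonempty block two partitions whose dimensions sum to at least
  \<open>m\<close>.\<close>

lemma has_cone_partition_standard_monomials:
  fixes X Y :: "'v set" and T :: "'j \<Rightarrow> 'v set"
  assumes X: "finite X" and Y: "finite Y" and XY: "X \<inter> Y = {}"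
    and J: "finite J" "k \<in> J" and Tk: "T k = X" and T: "\<And>j. j \<in> J \<Longrightarrow> T j \<subseteq> X \<union> Y"
    and pos: "\<And>j i. j \<in> J \<Longrightarrow> i \<in> T j \<Longrightarrow> 0 < b j i"
    and m: "m \<le> card Y"
    and parts: "\<And>\<tau> w. \<tau> \<noteq> {} \<Longrightarrow> \<tau> \<subseteq> J - {k} \<Longrightarrow> w \<in> exps (X \<inter> (\<Union>j\<in>\<tau>. T j)) \<Longrightarrow>
      \<forall>j\<in>\<tau>. w \<notin> pure_power_upset (T j) (b j) \<Longrightarrow>
      {v \<in> exps (X - (\<Union>j\<in>\<tau>. T j)). \<forall>j\<in>J - \<tau>. v + w \<in> pure_power_upset (T j) (b j)} \<noteq> {} \<Longrightarrow>
      \<exists>p q. m \<le> p + q \<and>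
        has_cone_partition (X - (\<Union>j\<in>\<tau>. T j))
          {v \<in> exps (X - (\<Union>j\<in>\<tau>. T j)). \<forall>j\<in>J - \<tau>. v + w \<in> pure_power_upset (T j) (b j)} p \<and>
        has_cone_partition Y {c \<in> exps Y. \<exists>j\<in>\<tau>. c \<notin> pure_power_upset (T j) (b j)} q"
  shows "has_cone_partition (X \<union> Y)
    {e \<in> exps (X \<union> Y). \<exists>j\<in>J. e \<notin> pure_power_upset (T j) (b j)} m"
proof -
  define G where "G j = pure_power_upset (T j) (b j)" for j
  define V where "V \<tau> = X - (\<Union>j\<in>\<tau>. T j)" for \<tau>
  define E1 where "E1 \<tau> w = {v \<in> exps (V \<tau>). \<forall>j\<in>J - \<tau>. v + w \<in> G j}" for \<tau> w
  define E2 where "E2 \<tau> = {c \<in> exps Y. \<exists>j\<in>\<tau>. c \<notin> G j}" for \<tau>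
  define I where "I = {(\<tau>, w). \<tau> \<noteq> {} \<and> \<tau> \<subseteq> J - {k} \<and> w \<in> exps (X \<inter> (\<Union>j\<in>\<tau>. T j)) \<and>
    (\<forall>j\<in>\<tau>. w \<notin> G j) \<and> E1 \<tau> w \<noteq> {}}"
  define P where "P = (\<lambda>(\<tau>, w). {w + v + c |v c. v \<in> E1 \<tau> w \<and> c \<in> E2 \<tau>})"
  define U where "U = {u \<in> exps X. u \<notin> G k}"
  \<comment> \<open>The idle summand 0 matches the shape in \<open>has_cone_partition_sum\<close>,
    with first factor \<open>exps {}\<close> and shift \<open>u\<close>.\<close>
  define F where "F u = {u + 0 + c |c. c \<in> exps Y}" for u
  have nXY: "i \<in> X \<Longrightarrow> i \<notin> Y" "i \<in> Y \<Longrightarrow> i \<notin> X" for i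
    using XY by auto
  have VX: "V \<tau> \<subseteq> X" for \<tau>
    by (auto simp: V_def)
  have add_iff: "x + c \<in> G j \<longleftrightarrow> x \<in> G j \<or> c \<in> G j" if "j \<in> J" "x \<in> exps X" "c \<in> exps Y" for j x c
    unfolding G_def using XY that pos by (intro pure_power_upset_add_iff) auto
  have add_exps: "x + c \<in> exps (X \<union> Y)" if "x \<in> exps X" "c \<in> exps Y" for x c
    using that by (simp add: exps_iff lookup_add)
  have restr_add: "restr X (x + c) = x" "restr Y (x + c) = c" if "x \<in> exps X" "c \<in> exps Y" for x c
    using that by (auto intro!: poly_mapping_eqI simp: lookup_restr lookup_add exps_iff nXY)
  obtain N where N: "\<And>j i. j \<in> J \<Longrightarrow> i \<in> T j \<Longrightarrow> b j i \<le> N"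
    using uniform_bound[of J T b] J(1) T X Y by (metis finite_UnI finite_subset)
  \<comment> \<open>Since \<open>T k = X\<close>, lying outside component \<open>k\<close> bounds
    the exponent of every variable in \<open>X\<close>.\<close>
  have "finite U"
  proof (rule finite_subset)
    show "U \<subseteq> {e \<in> exps X. \<forall>i. Poly_Mapping.lookup e i \<le> N}"
      using bounded_if_not_in_pure_power_upset[of _ T "{k}" b N] N[OF J(2)] Tk by (auto simp: U_def G_def)
  qed (rule finite_bounded_exps[OF X])
  have "finite I"
  proof (rule finite_subset)
    show "I \<subseteq> Pow J \<times> {e \<in> exps X. \<forall>i. Poly_Mapping.lookup e i \<le> N}"
    proof
      fix d assume "d \<in> I"
      then obtain \<tau> w where d: "d = (\<tau>, w)" "\<tau> \<subseteq> J - {k}" "w \<in> exps (X \<inter> (\<Union>j\<in>\<tau>. T j))" "\<forall>j\<in>\<tau>. w \<notin> G j"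
        by (auto simp: I_def)
      have "w \<in> exps X" "w \<in> exps (\<Union>j\<in>\<tau>. T j)"
        using d(3) by (auto simp: exps_def)
      moreover have "Poly_Mapping.lookup w i \<le> N" for i
        using bounded_if_not_in_pure_power_upset[of w T \<tau> b N i] \<open>w \<in> exps (\<Union>j\<in>\<tau>. T j)\<close> d N by (auto simp: G_def)
      ultimately show "d \<in> Pow J \<times> {e \<in> exps X. \<forall>i. Poly_Mapping.lookup e i \<le> N}"
        using d by auto
    qed
    show "finite (Pow J \<times> {e \<in> exps X. \<forall>i. Poly_Mapping.lookup e i \<le> N})"
      using J(1) finite_bounded_exps[OF X] by simp
  qed
  have F_part: "has_cone_partition (X \<union> Y) (F u) m" if "u \<in> U" for u
  proof -
    have z: "cone 0 Z = exps Z" for Z :: "'v set"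
      by (simp add: cone_def)
    have "has_cone_partition ({} \<union> Y) {u + a + c |a c. a \<in> exps {} \<and> c \<in> exps Y} (0 + card Y)"
      using has_cone_partition_cone[of "{}" "{} :: 'v set" 0] has_cone_partition_cone[of Y Y 0] Y
      unfolding z by (intro has_cone_partition_sum) auto
    moreover have "{u + a + c |a c. a \<in> exps {} \<and> c \<in> exps Y} = F u"
      by (auto simp: F_def exps_empty)
    ultimately show ?thesis
      using m by (auto intro: has_cone_partition_mono)
  qed
  have P_part: "has_cone_partition (X \<union> Y) (P d) m" if dI: "d \<in> I" for d
  proof -
    obtain \<tau> w where d: "d = (\<tau>, w)"
      by (cases d)
    obtain p q where pq: "m \<le> p + q" "has_cone_partition (V \<tau>) (E1 \<tau> w) p" "has_cone_partition Y (E2 \<tau>) q"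
      using parts[of \<tau> w] dI unfolding d I_def E1_def E2_def V_def G_def by auto
    have "has_cone_partition (V \<tau> \<union> Y) {w + v + c |v c. v \<in> E1 \<tau> w \<and> c \<in> E2 \<tau>} (p + q)"
      using pq(2,3) VX[of \<tau>] X Y XY finite_subset[OF VX[of \<tau>] X]
      by (intro has_cone_partition_sum) (auto simp: E1_def E2_def)
    then show ?thesis
      using pq(1) VX[of \<tau>] unfolding d P_def by (auto intro: has_cone_partition_mono)
  qed
  have F_eq: "restr X h \<in> U \<and> u = restr X h" if "u \<in> U" "h \<in> F u" for u h
    using that restr_add(1) by (auto simp: F_def U_def)
  \<comment> \<open>Beyond unpacking, this recovers the labels: both \<tau> and \<open>w\<close> are
    functions of the \<open>X\<close>-part \<open>w + v\<close>.\<close>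
  have P_elim: "\<exists>v c. h = (w + v) + c \<and> w + v \<in> exps X \<and> c \<in> exps Y \<and> v \<in> E1 \<tau> w \<and> c \<in> E2 \<tau> \<and>
      w \<in> exps X \<and> \<tau> \<subseteq> J - {k} \<and>
      \<tau> = {j\<in>J. w + v \<notin> G j} \<and> w = restr (\<Union>j\<in>\<tau>. T j) (w + v)"
    if dI: "(\<tau>, w) \<in> I" and h: "h \<in> P (\<tau>, w)" for \<tau> w h
  proof -
    obtain v c where vc: "h = w + v + c" "v \<in> E1 \<tau> w" "c \<in> E2 \<tau>"
      using h by (auto simp: P_def)
    have w: "w \<in> exps (X \<inter> (\<Union>j\<in>\<tau>. T j))" "\<tau> \<subseteq> J - {k}" "\<forall>j\<in>\<tau>. w \<notin> G j"
      using dI by (auto simp: I_def)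
    have v: "v \<in> exps (V \<tau>)" "\<forall>j\<in>J - \<tau>. w + v \<in> G j"
      using vc(2) by (auto simp: E1_def add.commute)
    have "w \<in> exps X"
      using w(1) by (auto simp: exps_def)
    have wvX: "w + v \<in> exps X"
      using w(1) v(1) VX[of \<tau>] by (intro exps_add) (auto simp: exps_def)
    \<comment> \<open>\<open>v\<close> has no variable in \<open>T j\<close>, so membership of the
      product is decided by \<open>w\<close>.\<close>
    have "w + v \<notin> G j" if j: "j \<in> \<tau>" for j
    proof -
      have "j \<in> J"
        using j w(2) by blast
      have "v \<notin> G j"
        unfolding G_def using v(1) pos[OF \<open>j \<in> J\<close>] j
        by (intro not_in_pure_power_upset[of v "V \<tau>"]) (auto simp: V_def)
      moreover have "w + v \<in> G j \<longleftrightarrow> w \<in> G j \<or> v \<in> G j"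
        unfolding G_def using w(1) v(1) pos[OF \<open>j \<in> J\<close>]
        by (intro pure_power_upset_add_iff[of "X \<inter> (\<Union>j\<in>\<tau>. T j)" "V \<tau>"]) (auto simp: V_def)
      ultimately show ?thesis
        using w(3) j by blast
    qed
    then have "\<tau> = {j\<in>J. w + v \<notin> G j}"
      using v(2) w(2) by blast
    moreover have "w = restr (\<Union>j\<in>\<tau>. T j) (w + v)"
      using w(1) v(1) by (intro poly_mapping_eqI) (auto simp: lookup_restr lookup_add exps_iff V_def)
    moreover have "c \<in> exps Y"
      using vc(3) by (simp add: E2_def)
    ultimately show ?thesis
      using vc wvX w(2) \<open>w \<in> exps X\<close> by blast
  qed
  have P_eq: "restr X h \<notin> U \<and> \<tau> = {j\<in>J. restr X h \<notin> G j} \<and> w = restr (\<Union>j\<in>\<tau>. T j) (restr X h)"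
    if dI: "(\<tau>, w) \<in> I" and h: "h \<in> P (\<tau>, w)" for \<tau> w h
  proof -
    obtain v c where vc: "h = (w + v) + c" "w + v \<in> exps X" "c \<in> exps Y" "\<tau> \<subseteq> J - {k}"
      "\<tau> = {j\<in>J. w + v \<notin> G j}" "w = restr (\<Union>j\<in>\<tau>. T j) (w + v)"
      using P_elim[OF dI h] by blast
    have "restr X h = w + v"
      unfolding vc(1) using vc(2,3) by (rule restr_add)
    \<comment> \<open>As \<open>k\<close> is not in \<tau>, the \<open>X\<close>-part lies in
      \<open>G k\<close>; this separates the two kinds of blocks.\<close>
    moreover have "w + v \<notin> U"
      using vc(4,5) J(2) by (auto simp: U_def)
    ultimately show ?thesis
      using vc(5,6) by simp
  qed
  have disj_F: "disjoint_family_on F U"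
    unfolding disjoint_family_on_def using F_eq by blast
  have disj_P: "disjoint_family_on P I"
    unfolding disjoint_family_on_def
  proof (intro ballI impI, rule ccontr)
    fix d d' assume d: "d \<in> I" "d' \<in> I" "d \<noteq> d'" "P d \<inter> P d' \<noteq> {}"
    obtain \<tau> w \<tau>' w' where dd: "d = (\<tau>, w)" "d' = (\<tau>', w')"
      by (metis surj_pair)
    obtain h where h: "h \<in> P (\<tau>, w)" "h \<in> P (\<tau>', w')"
      using d(4) dd by blast
    have "\<tau> = \<tau>'"
      using P_eq[of \<tau> w h] P_eq[of \<tau>' w' h] d dd h by blast
    then have "w = w'"
      using P_eq[of \<tau> w h] P_eq[of \<tau>' w' h] d dd h by metis
    then show False
      using \<open>\<tau> = \<tau>'\<close> d(3) dd by simp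
  qed
  have disj: "(\<Union>u\<in>U. F u) \<inter> (\<Union>d\<in>I. P d) = {}"
  proof (rule ccontr)
    assume "(\<Union>u\<in>U. F u) \<inter> (\<Union>d\<in>I. P d) \<noteq> {}"
    then obtain h u d where h: "u \<in> U" "h \<in> F u" "d \<in> I" "h \<in> P d"
      by blast
    then show False
      using F_eq[OF h(1,2)] P_eq[of "fst d" "snd d" h] by simp
  qed
  have eq: "{e \<in> exps (X \<union> Y). \<exists>j\<in>J. e \<notin> G j} = (\<Union>u\<in>U. F u) \<union> (\<Union>d\<in>I. P d)"
  proof (intro subset_antisym subsetI)
    fix h assume "h \<in> {e \<in> exps (X \<union> Y). \<exists>j\<in>J. e \<notin> G j}"
    then obtain j0 where h: "h \<in> exps (X \<union> Y)" "j0 \<in> J" "h \<notin> G j0"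
      by blast
    define x where "x = restr X h"
    define c where "c = restr Y h"
    have x: "x \<in> exps X" and c: "c \<in> exps Y"
      by (auto simp: x_def c_def exps_def keys_restr)
    have hxc: "h = x + c"
      using h(1) by (intro poly_mapping_eqI) (auto simp: x_def c_def lookup_restr lookup_add exps_iff nXY)
    show "h \<in> (\<Union>u\<in>U. F u) \<union> (\<Union>d\<in>I. P d)"
    proof (cases "x \<in> U")
      case True
      then show ?thesis
        using c hxc by (auto simp: F_def)
    next
      case False
      define \<tau> where "\<tau> = {j\<in>J. x \<notin> G j}"
      define w where "w = restr (\<Union>j\<in>\<tau>. T j) x"
      define v where "v = restr (V \<tau>) x"
      have xwv: "x = w + v"
        using x by (intro poly_mapping_eqI) (auto simp: w_def v_def V_def lookup_restr lookup_add exps_iff)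
      \<comment> \<open>An index witnessing that \<open>h\<close> is standard also witnesses that
        \<tau> is nonempty and that \<open>c\<close> is standard for \<tau>.\<close>
      have "x \<notin> G j0" "c \<notin> G j0"
        using add_iff[OF h(2) x c] h(3) hxc by auto
      then have "j0 \<in> \<tau>" "c \<in> E2 \<tau>"
        using h(2) c by (auto simp: \<tau>_def E2_def)
      have "v \<in> E1 \<tau> w"
        using xwv by (auto simp: E1_def \<tau>_def v_def exps_def keys_restr add.commute)
      have "w \<notin> G j" if "j \<in> \<tau>" for j
        using that xwv by (auto simp: \<tau>_def G_def pure_power_upset_def lookup_add)
      moreover have "\<tau> \<subseteq> J - {k}"
        using False x by (auto simp: \<tau>_def U_def)
      moreover have "w \<in> exps (X \<inter> (\<Union>j\<in>\<tau>. T j))"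
        using x by (auto simp: w_def exps_def keys_restr)
      ultimately have "(\<tau>, w) \<in> I"
        using \<open>j0 \<in> \<tau>\<close> \<open>v \<in> E1 \<tau> w\<close> by (auto simp: I_def)
      moreover have "h \<in> P (\<tau>, w)"
        using hxc xwv \<open>v \<in> E1 \<tau> w\<close> \<open>c \<in> E2 \<tau>\<close> by (auto simp: P_def)
      ultimately show ?thesis
        by blast
    qed
  next
    fix h assume "h \<in> (\<Union>u\<in>U. F u) \<union> (\<Union>d\<in>I. P d)"
    then show "h \<in> {e \<in> exps (X \<union> Y). \<exists>j\<in>J. e \<notin> G j}"
    proof
      assume "h \<in> (\<Union>u\<in>U. F u)"
      then obtain u c where u: "u \<in> exps X" "u \<notin> G k" "c \<in> exps Y" "h = u + c"
        by (auto simp: U_def F_def)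
      \<comment> \<open>Component \<open>k\<close> involves no variable of \<open>Y\<close>, so
        every \<open>c\<close> is allowed next to \<open>u\<close>.\<close>
      have "c \<notin> G k"
        unfolding G_def using u(3) XY Tk pos[OF J(2)] by (intro not_in_pure_power_upset[of c Y]) auto
      then have "h \<notin> G k"
        using add_iff[OF J(2) u(1,3)] u by simp
      moreover have "h \<in> exps (X \<union> Y)"
        unfolding u(4) using u(1,3) by (rule add_exps)
      ultimately show ?thesis
        using J(2) by blast
    next
      assume "h \<in> (\<Union>d\<in>I. P d)"
      then obtain \<tau> w where d: "(\<tau>, w) \<in> I" "h \<in> P (\<tau>, w)"
        by auto
      obtain v c where vc: "h = (w + v) + c" "w + v \<in> exps X" "c \<in> exps Y" "c \<in> E2 \<tau>"
        "\<tau> = {j\<in>J. w + v \<notin> G j}"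
        using P_elim[OF d] by blast
      obtain j where j: "j \<in> \<tau>" "c \<notin> G j"
        using vc(4) by (auto simp: E2_def)
      then have "j \<in> J" "w + v \<notin> G j"
        using vc(5) by auto
      then have "h \<notin> G j"
        using add_iff[OF \<open>j \<in> J\<close> vc(2,3)] j(2) vc(1) by simp
      moreover have "h \<in> exps (X \<union> Y)"
        unfolding vc(1) using vc(2,3) by (rule add_exps)
      ultimately show ?thesis
        using \<open>j \<in> J\<close> by blast
    qed
  qed
  have "has_cone_partition (X \<union> Y) ((\<Union>u\<in>U. F u) \<union> (\<Union>d\<in>I. P d)) m"
    using has_cone_partition_UN[OF \<open>finite U\<close> F_part disj_F] has_cone_partition_UN[OF \<open>finite I\<close> P_part disj_P]
      disj by (rule has_cone_partition_Un)
  then show ?thesis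
    using eq by (simp add: G_def)
qed

section \<open>The data attached to a presentation by pure powers\<close>

lemma ideal_sum_cong: "(\<And>j. j \<in> S \<Longrightarrow> A j = B j) \<Longrightarrow> ideal_sum S A = ideal_sum S B"
  by (auto simp: ideal_sum_def)

text \<open>Fixing \<open>T\<close> and \<open>b\<close> for all components at once turns each ideal
  attached to \<tau> and w into the span of an explicit exponent set.\<close>

locale pure_power_presentation =
  fixes n r s :: nat and Q :: "nat \<Rightarrow> (nat, 'k::field) mpol set"
    and T :: "nat \<Rightarrow> nat set" and b :: "nat \<Rightarrow> nat \<Rightarrow> nat"
  assumes r_le: "r \<le> n"
    and T_subset: "\<And>j. j \<in> {1..s} \<Longrightarrow> T j \<subseteq> {1..n}"
    and pos: "\<And>j i. j \<in> {1..s} \<Longrightarrow> i \<in> T j \<Longrightarrow> 0 < b j i"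
    and Q_eq: "\<And>j. j \<in> {1..s} \<Longrightarrow> Q j = polys (exps {1..n} \<inter> pure_power_upset (T j) (b j))"
begin

abbreviation G :: "nat \<Rightarrow> (nat \<Rightarrow>\<^sub>0 nat) set" where
  "G j \<equiv> pure_power_upset (T j) (b j)"

text \<open>The exponents of the intersected colon ideals in the ring \<open>S\<tau>\<close>;
  \<open>F\<tau>\<close> below collects the standard exponents of the quotient in the remaining
  variables.\<close>

definition E\<tau> :: "nat set \<Rightarrow> (nat \<Rightarrow>\<^sub>0 nat) \<Rightarrow> (nat \<Rightarrow>\<^sub>0 nat) set" where
  "E\<tau> \<tau> w = {v \<in> exps ({1..r} - (\<Union>j\<in>\<tau>. T j)). \<forall>j\<in>{1..s} - \<tau>. v + w \<in> G j}"

definition F\<tau> :: "nat set \<Rightarrow> (nat \<Rightarrow>\<^sub>0 nat) set" where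
  "F\<tau> \<tau> = {c \<in> exps {r+1..n}. \<exists>j\<in>\<tau>. c \<notin> G j}"

lemma var_in_radical_sum:
  assumes "\<tau> \<subseteq> {1..s}"
  shows "(var i :: (nat, 'k) mpol) \<in> ideal_sum \<tau> (\<lambda>j. radical {1..n} (Q j)) \<longleftrightarrow> i \<in> (\<Union>j\<in>\<tau>. T j)"
proof -
  have "ideal_sum \<tau> (\<lambda>j. radical {1..n} (Q j)) =
      ideal_sum \<tau> (\<lambda>j. radical {1..n} (polys (exps {1..n} \<inter> G j)))"
    using assms Q_eq by (intro ideal_sum_cong) (auto simp: subset_eq)
  also have "var i \<in> \<dots> \<longleftrightarrow> i \<in> (\<Union>j\<in>\<tau>. T j)"
  proof (rule var_in_radical_sum_iff)
    show "finite \<tau>"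
      using assms by (rule finite_subset) simp
    show "T j \<subseteq> {1..n}" if "j \<in> \<tau>" for j
      using that assms by (intro T_subset) blast
    show "0 < b j i" if "j \<in> \<tau>" "i \<in> T j" for j i
      using that assms by (intro pos) blast+
  qed
  finally show ?thesis .
qed

lemma vars_S\<tau>_eq:
  assumes "\<tau> \<subseteq> {1..s}"
  shows "vars_S\<tau> n r Q \<tau> = {1..r} - (\<Union>j\<in>\<tau>. T j)"
  unfolding vars_S\<tau>_def var_in_radical_sum[OF assms] by auto

lemma M\<tau>_eq:
  assumes "\<tau> \<subseteq> {1..s}"
  shows "M\<tau> n r Q \<tau> = mono ` {w \<in> exps ({1..r} \<inter> (\<Union>j\<in>\<tau>. T j)). \<forall>j\<in>\<tau>. w \<notin> G j}"
proof -
  have "ideal_sum \<tau> Q = ideal_sum \<tau> (\<lambda>j. polys (exps {1..n} \<inter> G j))"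
    using assms Q_eq by (intro ideal_sum_cong) (auto simp: subset_eq)
  then have "(mono w :: (nat, 'k) mpol) \<in> ideal_sum \<tau> Q \<longleftrightarrow> (\<exists>j\<in>\<tau>. w \<in> exps {1..n} \<inter> G j)" for w
    using mono_in_ideal_sum_polys_iff[of \<tau> w "\<lambda>j. exps {1..n} \<inter> G j"] finite_subset[OF assms] by simp
  moreover have "{i\<in>{1..n}. i \<in> (\<Union>j\<in>\<tau>. T j)} = (\<Union>j\<in>\<tau>. T j)"
    using assms T_subset by blast
  moreover have "exps {1..r} \<subseteq> exps {1..n}"
    using r_le by (intro exps_mono) auto
  ultimately show ?thesis
    unfolding M\<tau>_def var_in_radical_sum[OF assms] carrier_poly_ring monomials_def
    by (auto simp: mono_in_polys_iff) (auto simp: exps_def)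
qed

text \<open>Needed for the \<open>Min\<close> of the final statement to range over a finite
  set.\<close>

lemma finite_M\<tau>:
  assumes "\<tau> \<subseteq> {1..s}"
  shows "finite (M\<tau> n r Q \<tau>)"
proof -
  obtain N where N: "\<And>j i. j \<in> {1..s} \<Longrightarrow> i \<in> T j \<Longrightarrow> b j i \<le> N"
    using uniform_bound[of "{1..s}" T b] T_subset by (meson finite_atLeastAtMost finite_subset)
  have "{w \<in> exps ({1..r} \<inter> (\<Union>j\<in>\<tau>. T j)). \<forall>j\<in>\<tau>. w \<notin> G j} \<subseteq>
      {w \<in> exps {1..r}. \<forall>i. Poly_Mapping.lookup w i \<le> N}"
  proof
    fix w assume "w \<in> {w \<in> exps ({1..r} \<inter> (\<Union>j\<in>\<tau>. T j)). \<forall>j\<in>\<tau>. w \<notin> G j}"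
    then have "w \<in> exps {1..r}" "w \<in> exps (\<Union>j\<in>\<tau>. T j)" "\<And>j. j \<in> \<tau> \<Longrightarrow> w \<notin> G j"
      by (auto simp: exps_def)
    then show "w \<in> {w \<in> exps {1..r}. \<forall>i. Poly_Mapping.lookup w i \<le> N}"
      using bounded_if_not_in_pure_power_upset[of w T \<tau> b N] N assms by blast
  qed
  then have "finite {w \<in> exps ({1..r} \<inter> (\<Union>j\<in>\<tau>. T j)). \<forall>j\<in>\<tau>. w \<notin> G j}"
    by (rule finite_subset) (rule finite_bounded_exps, simp)
  then show ?thesis
    unfolding M\<tau>_eq[OF assms] by (rule finite_imageI)
qed

lemma colon_module_ideal:
  assumes "\<tau> \<subseteq> {1..s}" "w \<in> exps {1..r}"
  shows "(\<Inter>j\<in>{1..s} - \<tau>. colon {1..n} (Q j) (mono w)) \<inter> carrier (S\<tau> n r Q \<tau>) = polys (E\<tau> \<tau> w)"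
proof -
  have "(\<Inter>j\<in>{1..s} - \<tau>. colon {1..n} (Q j) (mono w)) =
      (\<Inter>j\<in>{1..s} - \<tau>. polys {e \<in> exps {1..n}. e + w \<in> exps {1..n} \<inter> G j})"
    by (intro INF_cong refl) (simp add: Q_eq colon_polys)
  moreover have "(\<Inter>j\<in>{1..s} - \<tau>. {e \<in> exps {1..n}. e + w \<in> exps {1..n} \<inter> G j}) \<inter>
      exps ({1..r} - (\<Union>j\<in>\<tau>. T j)) = E\<tau> \<tau> w"
  proof -
    have "exps ({1..r} - (\<Union>j\<in>\<tau>. T j)) \<subseteq> exps {1..n}" "exps {1..r} \<subseteq> exps {1..n}"
      using r_le by (auto intro!: exps_mono)
    then show ?thesis
      using assms(2) by (auto simp: E\<tau>_def intro!: exps_add)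
  qed
  ultimately show ?thesis
    unfolding S\<tau>_def carrier_poly_ring vars_S\<tau>_eq[OF assms(1)] by (simp add: INT_polys polys_Int)
qed

lemma contracted_ideal:
  assumes "\<tau> \<subseteq> {1..s}"
  shows "(\<Inter>j\<in>\<tau>. Q j) \<inter> carrier (poly_ring {r+1..n}) =
    polys (exps {r+1..n} \<inter> (\<Inter>j\<in>\<tau>. G j))"
proof -
  have "(\<Inter>j\<in>\<tau>. Q j) = (\<Inter>j\<in>\<tau>. polys (exps {1..n} \<inter> G j))"
    using assms Q_eq by (intro INF_cong) auto
  moreover have "exps {r+1..n} \<subseteq> exps {1..n}"
    by (intro exps_mono) auto
  then have "(\<Inter>j\<in>\<tau>. exps {1..n} \<inter> G j) \<inter> exps {r+1..n} = exps {r+1..n} \<inter> (\<Inter>j\<in>\<tau>. G j)"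
    by blast
  ultimately show ?thesis
    unfolding carrier_poly_ring by (simp only: INT_polys polys_Int)
qed

lemma zero_notin_G: "j \<in> {1..s} \<Longrightarrow> 0 \<notin> G j"
  using pos by (intro not_in_pure_power_upset[of 0 "{}"]) (auto simp: zero_in_exps)

text \<open>Truncation at a bound for all \<open>b j i\<close> yields some partition of
  \<open>E\<tau> \<tau> w\<close>; hence the Stanley depth is attained.\<close>

lemma has_cone_partition_colon_module:
  assumes "\<tau> \<subseteq> {1..s}" "E\<tau> \<tau> w \<noteq> {}" "w \<in> exps {1..r}"
  shows "has_cone_partition ({1..r} - (\<Union>j\<in>\<tau>. T j)) (E\<tau> \<tau> w)
    (sdepth (vars_S\<tau> n r Q \<tau>)
      (ideal_module ((\<Inter>j\<in>{1..s} - \<tau>. colon {1..n} (Q j) (mono w)) \<inter> carrier (S\<tau> n r Q \<tau>))))"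
proof -
  let ?V = "{1..r} - (\<Union>j\<in>\<tau>. T j)"
  have up: "monomial_upset ?V (E\<tau> \<tau> w)"
    unfolding monomial_upset_def E\<tau>_def
    by (auto simp: add.assoc intro!: exps_add pure_power_upset_add[of "_ + w"])
  interpret monomial_subquotient ?V "E\<tau> \<tau> w" "E\<tau> \<tau> w" "ideal_module (polys (E\<tau> \<tau> w) :: (nat, 'k) mpol set)" id
    by (rule monomial_subquotient_ideal_module[OF _ up]) simp
  obtain N where N: "\<And>j i. j \<in> {1..s} \<Longrightarrow> i \<in> T j \<Longrightarrow> b j i \<le> N"
    using uniform_bound[of "{1..s}" T b] T_subset by (meson finite_atLeastAtMost finite_subset)
  have "has_cone_partition ?V (E\<tau> \<tau> w) 0"
  proof (rule has_cone_partition_truncation_invariant)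
    fix e assume "e \<in> exps ?V"
    then have "Poly_Mapping.map (min N) e \<in> exps ?V"
      by (simp add: exps_iff lookup_map_min)
    then show "e \<in> E\<tau> \<tau> w \<longleftrightarrow> Poly_Mapping.map (min N) e \<in> E\<tau> \<tau> w"
      using \<open>e \<in> exps ?V\<close> map_min_in_pure_power_upset_iff[of "T _" "b _" N] N by (auto simp: E\<tau>_def)
  qed (auto simp: E\<tau>_def)
  then show ?thesis
    unfolding colon_module_ideal[OF assms(1,3)] vars_S\<tau>_eq[OF assms(1)]
    using assms(2) by (rule has_cone_partition_sdepth)
qed

lemma has_cone_partition_contracted_quotient:
  assumes "\<tau> \<subseteq> {1..s}" "\<tau> \<noteq> {}"
  shows "has_cone_partition {r+1..n} (F\<tau> \<tau>)
    (sdepth {r+1..n} (quotient_module {r+1..n} ((\<Inter>j\<in>\<tau>. Q j) \<inter> carrier (poly_ring {r+1..n}))))"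
proof -
  let ?N = "exps {r+1..n} \<inter> (\<Inter>j\<in>\<tau>. G j)"
  have up: "monomial_upset {r+1..n} ?N"
    by (auto simp: monomial_upset_def intro!: exps_add pure_power_upset_add)
  have F_eq: "exps {r+1..n} - ?N = F\<tau> \<tau>"
    by (auto simp: F\<tau>_def)
  interpret monomial_subquotient "{r+1..n}" "exps {r+1..n}" "exps {r+1..n} - ?N"
    "quotient_module {r+1..n} (polys ?N :: (nat, 'k) mpol set)" "\<lambda>f. polys ?N +>\<^bsub>poly_ring {r+1..n}\<^esub> f"
    by (rule monomial_subquotient_quotient_module[OF _ up]) simp
  obtain N where N: "\<And>j i. j \<in> {1..s} \<Longrightarrow> i \<in> T j \<Longrightarrow> b j i \<le> N"
    using uniform_bound[of "{1..s}" T b] T_subset by (meson finite_atLeastAtMost finite_subset)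
  have part: "has_cone_partition {r+1..n} (F\<tau> \<tau>) 0"
  proof (rule has_cone_partition_truncation_invariant)
    fix e :: "nat \<Rightarrow>\<^sub>0 nat" assume "e \<in> exps {r+1..n}"
    then have "Poly_Mapping.map (min N) e \<in> exps {r+1..n}"
      by (simp add: exps_iff lookup_map_min)
    moreover have "Poly_Mapping.map (min N) e \<in> G j \<longleftrightarrow> e \<in> G j" if "j \<in> \<tau>" for j
      using map_min_in_pure_power_upset_iff[of "T j" "b j" N e 0] N[of j] assms(1) that by auto
    ultimately show "e \<in> F\<tau> \<tau> \<longleftrightarrow> Poly_Mapping.map (min N) e \<in> F\<tau> \<tau>"
      using \<open>e \<in> exps {r+1..n}\<close> by (auto simp: F\<tau>_def)
  qed (auto simp: F\<tau>_def)
  obtain j where "j \<in> \<tau>" "j \<in> {1..s}"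
    using assms by blast
  \<comment> \<open>All exponents of generators are positive, so each component is proper and the
    quotient contains the class of 1.\<close>
  then have "0 \<in> F\<tau> \<tau>"
    using zero_notin_G zero_in_exps unfolding F\<tau>_def by blast
  then have "F\<tau> \<tau> \<noteq> {}"
    by blast
  then show ?thesis
    unfolding contracted_ideal[OF assms(1)] using has_cone_partition_sdepth[unfolded F_eq, OF part] by simp
qed

text \<open>A vector \<open>v\<close> in the block gives the nonzero element
  \<open>mono w * mono v\<close>, so every block that occurs is one over which the minimum is
  taken.\<close>

lemma nonzero_intersection:
  assumes "\<tau> \<subseteq> {1..s}" "w \<in> exps {1..r}" "E\<tau> \<tau> w \<noteq> {}"
  shows "(\<Inter>j\<in>{1..s} - \<tau>. Q j) \<inter> {mono w * f |f. f \<in> carrier (S\<tau> n r Q \<tau>)} \<noteq> {0}"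
proof -
  obtain v where v: "v \<in> exps ({1..r} - (\<Union>j\<in>\<tau>. T j))" "\<And>j. j \<in> {1..s} - \<tau> \<Longrightarrow> v + w \<in> G j"
    using assms(3) by (auto simp: E\<tau>_def)
  have "exps ({1..r} - (\<Union>j\<in>\<tau>. T j)) \<subseteq> exps {1..n}" "exps {1..r} \<subseteq> exps {1..n}"
    using r_le by (auto intro!: exps_mono)
  then have "v + w \<in> exps {1..n}"
    using v(1) assms(2) by (intro exps_add) auto
  then have "(mono (v + w) :: (nat, 'k) mpol) \<in> (\<Inter>j\<in>{1..s} - \<tau>. Q j)"
    using v(2) by (auto simp: Q_eq mono_in_polys_iff)
  moreover have "(mono (v + w) :: (nat, 'k) mpol) = mono w * mono v"
    by (simp add: mono_def mult_single add.commute)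
  moreover have "(mono v :: (nat, 'k) mpol) \<in> carrier (S\<tau> n r Q \<tau>)"
    using v(1) by (simp add: S\<tau>_def carrier_poly_ring vars_S\<tau>_eq[OF assms(1)] mono_in_polys_iff)
  moreover have "(mono (v + w) :: (nat, 'k) mpol) \<noteq> 0"
    unfolding mono_def by (metis keys_single keys_zero insert_not_empty one_neq_zero)
  ultimately show ?thesis
    by blast
qed

text \<open>The bound is stated for an arbitrary \<open>m\<close> below all competing values, which
  keeps the \<open>Min\<close> and its finiteness out of the argument.\<close>

lemma sdepth_quotient_ge:
  assumes k: "k \<in> {1..s}" "T k = {1..r}"
    and m: "m \<le> n - r"
    and parts: "\<And>\<tau> w. \<tau> \<noteq> {} \<Longrightarrow> \<tau> \<subset> {1..s} \<Longrightarrow> mono w \<in> M\<tau> n r Q \<tau> \<Longrightarrow>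
      (\<Inter>j\<in>{1..s} - \<tau>. Q j) \<inter> {mono w * f |f. f \<in> carrier (S\<tau> n r Q \<tau>)} \<noteq> {0} \<Longrightarrow>
      m \<le> sdepth (vars_S\<tau> n r Q \<tau>)
          (ideal_module ((\<Inter>j\<in>{1..s} - \<tau>. colon {1..n} (Q j) (mono w)) \<inter> carrier (S\<tau> n r Q \<tau>))) +
        sdepth {r+1..n}
          (quotient_module {r+1..n} ((\<Inter>j\<in>\<tau>. Q j) \<inter> carrier (poly_ring {r+1..n})))"
  shows "m \<le> sdepth {1..n} (quotient_module {1..n} (\<Inter>j\<in>{1..s}. Q j))"
proof -
  have XY: "{1..r} \<union> {r+1..n} = {1..n}"
    using r_le by auto
  have "has_cone_partition ({1..r} \<union> {r+1..n}) {e \<in> exps ({1..r} \<union> {r+1..n}). \<exists>j\<in>{1..s}. e \<notin> G j} m"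
  proof (rule has_cone_partition_standard_monomials[where k = k])
    show "m \<le> card {r+1..n}"
      using m by simp
    fix \<tau> w
    assume \<tau>: "\<tau> \<noteq> {}" "\<tau> \<subseteq> {1..s} - {k}" and w: "w \<in> exps ({1..r} \<inter> (\<Union>j\<in>\<tau>. T j))" "\<forall>j\<in>\<tau>. w \<notin> G j"
      and "{v \<in> exps ({1..r} - (\<Union>j\<in>\<tau>. T j)). \<forall>j\<in>{1..s} - \<tau>. v + w \<in> G j} \<noteq> {}"
    then have E: "E\<tau> \<tau> w \<noteq> {}"
      by (simp add: E\<tau>_def)
    \<comment> \<open>Omitting \<open>k\<close> makes \<tau> a proper subset.\<close>
    have \<tau>': "\<tau> \<subseteq> {1..s}" "\<tau> \<subset> {1..s}"
      using \<tau>(2) k(1) by auto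
    have wX: "w \<in> exps {1..r}"
      using w(1) by (auto simp: exps_def)
    have "mono w \<in> M\<tau> n r Q \<tau>"
      unfolding M\<tau>_eq[OF \<tau>'(1)] using w by blast
    note le = parts[OF \<tau>(1) \<tau>'(2) this nonzero_intersection[OF \<tau>'(1) wX E]]
    show "\<exists>p q. m \<le> p + q \<and>
        has_cone_partition ({1..r} - (\<Union>j\<in>\<tau>. T j))
          {v \<in> exps ({1..r} - (\<Union>j\<in>\<tau>. T j)). \<forall>j\<in>{1..s} - \<tau>. v + w \<in> G j} p \<and>
        has_cone_partition {r+1..n} {c \<in> exps {r+1..n}. \<exists>j\<in>\<tau>. c \<notin> G j} q"
      using le has_cone_partition_colon_module[OF \<tau>'(1) E wX]
        has_cone_partition_contracted_quotient[OF \<tau>'(1) \<tau>(1)]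
      unfolding E\<tau>_def F\<tau>_def by blast
  next
    show "T j \<subseteq> {1..r} \<union> {r+1..n}" if "j \<in> {1..s}" for j
      unfolding XY using that by (rule T_subset)
  qed (use k pos in auto)
  then have part: "has_cone_partition {1..n} {e \<in> exps {1..n}. \<exists>j\<in>{1..s}. e \<notin> G j} m"
    by (simp only: XY)
  let ?N = "exps {1..n} \<inter> (\<Inter>j\<in>{1..s}. G j)"
  have E_eq: "exps {1..n} - ?N = {e \<in> exps {1..n}. \<exists>j\<in>{1..s}. e \<notin> G j}"
    by auto
  have up: "monomial_upset {1..n} ?N"
    by (auto simp: monomial_upset_def intro!: exps_add pure_power_upset_add)
  interpret monomial_subquotient "{1..n}" "exps {1..n}" "exps {1..n} - ?N"
    "quotient_module {1..n} (polys ?N :: (nat, 'k) mpol set)" "\<lambda>f. polys ?N +>\<^bsub>poly_ring {1..n}\<^esub> f"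
    by (rule monomial_subquotient_quotient_module[OF _ up]) simp
  have "0 \<in> exps {1..n} - ?N"
    using k(1) zero_notin_G zero_in_exps by blast
  then have "exps {1..n} - ?N \<noteq> {}"
    by blast
  moreover have "(\<Inter>j\<in>{1..s}. Q j) = polys ?N"
  proof -
    have "(\<Inter>j\<in>{1..s}. Q j) = (\<Inter>j\<in>{1..s}. polys (exps {1..n} \<inter> G j))"
      using Q_eq by (intro INF_cong) auto
    moreover have "(\<Inter>j\<in>{1..s}. exps {1..n} \<inter> G j) = ?N"
      using k(1) by blast
    ultimately show ?thesis
      by (simp only: INT_polys)
  qed
  ultimately show ?thesis
    using sdepth_ge[of m] part unfolding E_eq by simp
qed

end

theorem theorem2p7:
  fixes n r s :: nat
    and a :: "nat \<Rightarrow> nat"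
    and I :: "(nat, 'k::field) mpol set"
    and Q :: "nat \<Rightarrow> (nat, 'k) mpol set"
  assumes "1 \<le> r" and "r \<le> n" and "2 \<le> s"
    and "monomial_ideal {1..n} I"
    and "irredundant_irreducible_presentation {1..n} s Q I"
    and "\<forall>i\<in>{1..r}. 0 < a i"
    and "\<exists>k\<in>{1..s}. Q k = Idl\<^bsub>poly_ring {1..n}\<^esub> {var i ^ a i |i. i \<in> {1..r}}"
  shows "sdepth {1..n} (quotient_module {1..n} I) \<ge>
    Min (insert (n - r)
      {sdepth (vars_S\<tau> n r Q \<tau>)
          (ideal_module ((\<Inter>j\<in>{1..s} - \<tau>. colon {1..n} (Q j) w) \<inter> carrier (S\<tau> n r Q \<tau>))) +
       sdepth {r+1..n}
          (quotient_module {r+1..n} ((\<Inter>j\<in>\<tau>. Q j) \<inter> carrier (poly_ring {r+1..n}))) |\<tau> w.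
       \<tau> \<noteq> {} \<and> \<tau> \<subset> {1..s} \<and> w \<in> M\<tau> n r Q \<tau> \<and>
       (\<Inter>j\<in>{1..s} - \<tau>. Q j) \<inter> {w * f |f. f \<in> carrier (S\<tau> n r Q \<tau>)} \<noteq> {0}})"
    (is "_ \<ge> Min (insert _ ?R)")
proof -
  obtain k where k: "k \<in> {1..s}" "Q k = Idl\<^bsub>poly_ring {1..n}\<^esub> {var i ^ a i |i. i \<in> {1..r}}"
    using assms(7) by blast
  have irr: "irreducible_monomial_ideal {1..n} (Q j)" if "j \<in> {1..s}" for j
    using assms(5) that by (simp add: irredundant_irreducible_presentation_def)
  have I_eq: "I = (\<Inter>j\<in>{1..s}. Q j)"
    using assms(5) by (simp add: irredundant_irreducible_presentation_def)
  \<comment> \<open>Component \<open>k\<close> receives the given exponents \<open>a\<close> instead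
    of data extracted from its irreducibility, so its variables are \<open>{1..r}\<close> by
    construction.\<close>
  have "\<exists>Tb. fst Tb \<subseteq> {1..n} \<and> (\<forall>i\<in>fst Tb. 0 < snd Tb i) \<and>
      Q j = polys (exps {1..n} \<inter> pure_power_upset (fst Tb) (snd Tb)) \<and> (j = k \<longrightarrow> fst Tb = {1..r})"
    if j: "j \<in> {1..s}" for j
  proof (cases "j = k")
    case True
    have "{var i ^ a i |i. i \<in> {1..r}} = {(var i :: (nat, 'k) mpol) ^ m |i m. i \<in> {1..r} \<and> m = a i}"
      by auto
    then have "Q j = Idl\<^bsub>poly_ring {1..n}\<^esub> {var i ^ m |i m. i \<in> {1..r} \<and> m = a i}"
      using True k(2) by simp
    also have "\<dots> = polys {e \<in> exps {1..n}. \<exists>i\<in>{1..r}. \<exists>m. m = a i \<and> m \<le> Poly_Mapping.lookup e i}"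
      using assms(2) by (intro Idl_pure_powers) auto
    also have "{e \<in> exps {1..n}. \<exists>i\<in>{1..r}. \<exists>m. m = a i \<and> m \<le> Poly_Mapping.lookup e i} =
        exps {1..n} \<inter> pure_power_upset {1..r} a"
      by (auto simp: pure_power_upset_def)
    finally show ?thesis
      using assms(2,6) by (intro exI[of _ "({1..r}, a)"]) auto
  next
    case False
    obtain T b where "T \<subseteq> {1..n}" "\<And>i. i \<in> T \<Longrightarrow> 0 < b i"
      "Q j = polys (exps {1..n} \<inter> pure_power_upset T b)"
      using irreducible_monomial_ideal_pure_power[OF irr[OF j]] by blast
    then show ?thesis
      using False by (intro exI[of _ "(T, b)"]) auto
  qed
  then obtain Tb where Tb: "\<And>j. j \<in> {1..s} \<Longrightarrow> fst (Tb j) \<subseteq> {1..n} \<and> (\<forall>i\<in>fst (Tb j). 0 < snd (Tb j) i) \<and>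
      Q j = polys (exps {1..n} \<inter> pure_power_upset (fst (Tb j)) (snd (Tb j))) \<and>
      (j = k \<longrightarrow> fst (Tb j) = {1..r})"
    by metis
  interpret pure_power_presentation n r s Q "\<lambda>j. fst (Tb j)" "\<lambda>j. snd (Tb j)"
    using Tb assms(2) by unfold_locales blast+
  let ?val = "\<lambda>(\<tau>, w). sdepth (vars_S\<tau> n r Q \<tau>)
      (ideal_module ((\<Inter>j\<in>{1..s} - \<tau>. colon {1..n} (Q j) w) \<inter> carrier (S\<tau> n r Q \<tau>))) +
    sdepth {r+1..n} (quotient_module {r+1..n} ((\<Inter>j\<in>\<tau>. Q j) \<inter> carrier (poly_ring {r+1..n})))"
  \<comment> \<open>The values are indexed by pairs from finitely many finite sets, so
    \<open>Min\<close> really is a lower bound for each of them.\<close>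
  have "?R \<subseteq> ?val ` (SIGMA \<tau>:Pow {1..s}. M\<tau> n r Q \<tau>)"
    by force
  moreover have "finite (SIGMA \<tau>:Pow {1..s}. M\<tau> n r Q \<tau>)"
    using finite_M\<tau> by (intro finite_SigmaI) auto
  ultimately have fin: "finite (insert (n - r) ?R)"
    by (meson finite_imageI finite_insert finite_subset)
  show ?thesis
    unfolding I_eq
  proof (rule sdepth_quotient_ge[OF k(1)])
    show "fst (Tb k) = {1..r}"
      using Tb[OF k(1)] by blast
    show "Min (insert (n - r) ?R) \<le> n - r"
      using fin by (intro Min_le) auto
    fix \<tau> w
    assume "\<tau> \<noteq> {}" "\<tau> \<subset> {1..s}" "mono w \<in> M\<tau> n r Q \<tau>"
      "(\<Inter>j\<in>{1..s} - \<tau>. Q j) \<inter> {mono w * f |f. f \<in> carrier (S\<tau> n r Q \<tau>)} \<noteq> {0}"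
    then show "Min (insert (n - r) ?R) \<le> sdepth (vars_S\<tau> n r Q \<tau>)
          (ideal_module ((\<Inter>j\<in>{1..s} - \<tau>. colon {1..n} (Q j) (mono w)) \<inter> carrier (S\<tau> n r Q \<tau>))) +
        sdepth {r+1..n}
          (quotient_module {r+1..n} ((\<Inter>j\<in>\<tau>. Q j) \<inter> carrier (poly_ring {r+1..n})))"
      by (intro Min_le[OF fin] insertI2 CollectI exI[of _ \<tau>] exI[of _ "mono w"] conjI refl)
  qed
qed

end
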